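(* Consider the sequence $(\mathcal X^n)_{n\ge1}$ of market models on finite probability spaces described in the context, and let $\mathbf M^n\neq\emptyset$ for every $n$. Then for every $n$ there exists a unique minimal reverse entropy martingale measure $\widehat{\mathsf Q}^n\in\mathbf M^n$, that is, $$ H(\mathsf P^n|\widehat{\mathsf Q}^n)\le H(\mathsf P^n|\mathsf Q^n),\quad \mathsf Q^n\in\mathbf M^n,$$ and the following relations hold true: $$ \mathrm{NAA} \iff (\mathsf P^n)\lhd (\widehat{\mathsf Q}^n);\qquad \mathrm{SAA} \iff (\mathsf P^n)\bigtriangleup (\widehat{\mathsf Q}^n). $$
   Context: For every $n\ge1$ the set $\Omega^n$ is finite, $(\Omega^n,\mathcal F^n_T,\mathsf P^n)$ is a probability space with filtration $\mathbb F^n=(\mathcal F^n_t)_{t\in\mathbb T^n}$, $\mathbb T^n=\{0,\dots,T(n)\}$, and $\mathcal F^n_0$ is trivial up to $\mathsf P^n$-null sets. A subscript $T$ means $T(n)$. There is an $\mathbb F^n$-adapted process $S^n_t=(S^{1,n}_t,\dots,S^{d(n),n}_t)$, $t\in\mathbb T^n$, of discounted stock prices. $\mathcal X^n$ is the set of processes $X^n$ of the form $$X^n_t=x^n+\sum_{j=1}^t(\gamma^n_j,S^n_j-S^n_{j-1})\ge0,\quad t=0,\dots,T(n),$$ where $x^n\in\mathbb R$, $\gamma^n=(\gamma^{1,n},\dots,\gamma^{d(n),n})$ is an $\mathbb F^n$-predictable process (i.e. $\gamma^n_j$ is $\mathcal F^n_{j-1}$-measurable), and $(x,y)$ is the scalar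 product. $\mathbf M^n$ is the set of probability measures equivalent to $\mathsf P^n$ under which $S^n$ is a martingale. $H(\mathsf P|\mathsf Q)=\mathsf E_{\mathsf P}\ln(d\mathsf P/d\mathsf Q)$ is the entropy of $\mathsf P$ with respect to an equivalent measure $\mathsf Q$. NAA (no asymptotic arbitrage): for any sequence $X^n\in\mathcal X^n$, $X^n_0\to0$ implies $\limsup_{n\to\infty}\mathsf P^n(X^n_T\ge1)=0$. SAA (strong asymptotic arbitrage): there is a sequence $X^n\in\mathcal X^n$ with $X^n_0\to0$ and $\limsup_{n\to\infty}\mathsf P^n(X^n_T\ge1)=1$. For probability measures $\mathsf P^n,\mathsf Q^n$ on $\mathcal F^n_T$: $(\mathsf P^n)\lhd(\mathsf Q^n)$ (contiguity) means that $\mathsf Q^n(A^n)\to0$, $A^n\in\mathcal F^n_T$, implies $\mathsf P^n(A^n)\to0$; $(\mathsf P^n)\bigtriangleup(\mathsf Q^n)$ (entire separation) means that there exist natural numbers $n_k\uparrow\infty$ and sets $A^{n_k}\in\mathcal F^{n_k}_T$ with $\mathsf P^{n_k}(A^{n_k})\to1$ and $\mathsf Q^{n_k}(A^{n_k})\to0$ as $k\to\infty$. *)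

theory Defs
  imports "HOL-Probability.Probability"
begin

text \<open>
  A finite-horizon market. The sample space and the final \<open>\<sigma>\<close>-algebra are the space and the sets of
  \<open>prob\<^sub>m\<close>. As usual in the library, \<open>info\<^sub>m m t\<close> is a measure used only through its space and its sets.
  \<open>price\<^sub>m m t i\<close> is the discounted price of stock \<open>i \<in> {1..dim\<^sub>m m}\<close> at time \<open>t \<in> {0..horizon\<^sub>m m}\<close>;
  values outside these index ranges are irrelevant.
\<close>

record 'a market =
  prob\<^sub>m :: "'a measure"
  horizon\<^sub>m :: nat
  dim\<^sub>m :: nat
  info\<^sub>m :: "nat \<Rightarrow> 'a measure"
  price\<^sub>m :: "nat \<Rightarrow> nat \<Rightarrow> 'a \<Rightarrow> real"

definition finite_market :: "'a market \<Rightarrow> bool" where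
  "finite_market m \<longleftrightarrow>
     prob_space (prob\<^sub>m m) \<and> finite (space (prob\<^sub>m m)) \<and>
     (\<forall>t\<le>horizon\<^sub>m m. subalgebra (prob\<^sub>m m) (info\<^sub>m m t)) \<and>
     (\<forall>t\<le>horizon\<^sub>m m. \<forall>s\<le>t. subalgebra (info\<^sub>m m t) (info\<^sub>m m s)) \<and>
     sets (info\<^sub>m m (horizon\<^sub>m m)) = sets (prob\<^sub>m m) \<and>
     (\<forall>A\<in>sets (info\<^sub>m m 0). measure (prob\<^sub>m m) A = 0 \<or> measure (prob\<^sub>m m) A = 1) \<and>
     (\<forall>t\<le>horizon\<^sub>m m. \<forall>i\<in>{1..dim\<^sub>m m}. price\<^sub>m m t i \<in> borel_measurable (info\<^sub>m m t))"

definition predictable :: "'a market \<Rightarrow> (nat \<Rightarrow> nat \<Rightarrow> 'a \<Rightarrow> real) \<Rightarrow> bool" where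
  "predictable m \<gamma> \<longleftrightarrow>
     (\<forall>j\<in>{1..horizon\<^sub>m m}. \<forall>i\<in>{1..dim\<^sub>m m}. \<gamma> j i \<in> borel_measurable (info\<^sub>m m (j - 1)))"

definition gains :: "'a market \<Rightarrow> (nat \<Rightarrow> nat \<Rightarrow> 'a \<Rightarrow> real) \<Rightarrow> nat \<Rightarrow> 'a \<Rightarrow> real" where
  "gains m \<gamma> t \<omega> =
     (\<Sum>j=1..t. \<Sum>i=1..dim\<^sub>m m. \<gamma> j i \<omega> * (price\<^sub>m m j i \<omega> - price\<^sub>m m (j - 1) i \<omega>))"

text \<open>
  The reference measure may have null atoms, so nonnegativity is required almost surely.
\<close>

definition wealth_processes :: "'a market \<Rightarrow> (nat \<Rightarrow> 'a \<Rightarrow> real) set" where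
  "wealth_processes m =
     {X. (\<exists>x \<gamma>. predictable m \<gamma> \<and>
            (\<forall>t\<le>horizon\<^sub>m m. \<forall>\<omega>\<in>space (prob\<^sub>m m). X t \<omega> = x + gains m \<gamma> t \<omega>)) \<and>
         (\<forall>t\<le>horizon\<^sub>m m. AE \<omega> in prob\<^sub>m m. 0 \<le> X t \<omega>)}"

definition martingale_upto ::
  "nat \<Rightarrow> (nat \<Rightarrow> 'a measure) \<Rightarrow> 'a measure \<Rightarrow> (nat \<Rightarrow> 'a \<Rightarrow> real) \<Rightarrow> bool" where
  "martingale_upto T F Q Y \<longleftrightarrow>
     (\<forall>t\<le>T. Y t \<in> borel_measurable (F t) \<and> integrable Q (Y t)) \<and>
     (\<forall>t\<le>T. \<forall>s\<le>t. AE \<omega> in Q. real_cond_exp Q (F s) (Y t) \<omega> = Y s \<omega>)"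

definition equivalent_measures :: "'a measure \<Rightarrow> 'a measure \<Rightarrow> bool" where
  "equivalent_measures P Q \<longleftrightarrow>
     sets Q = sets P \<and> absolutely_continuous P Q \<and> absolutely_continuous Q P"

definition martingale_measures :: "'a market \<Rightarrow> 'a measure set" where
  "martingale_measures m =
     {Q. prob_space Q \<and> equivalent_measures (prob\<^sub>m m) Q \<and>
         (\<forall>i\<in>{1..dim\<^sub>m m}.
            martingale_upto (horizon\<^sub>m m) (info\<^sub>m m) Q (\<lambda>t. price\<^sub>m m t i))}"

text \<open>
  \<open>H(P|Q)\<close>, the \<open>P\<close>-expectation of \<open>ln (dP/dQ)\<close>; in \<open>KL_divergence\<close> the reference measure \<open>Q\<close> comes first.
\<close>

definition rel_entropy :: "'a measure \<Rightarrow> 'a measure \<Rightarrow> real" where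
  "rel_entropy P Q = KL_divergence (exp 1) Q P"

definition min_reverse_entropy_mm :: "'a market \<Rightarrow> 'a measure \<Rightarrow> bool" where
  "min_reverse_entropy_mm m Q \<longleftrightarrow>
     Q \<in> martingale_measures m \<and>
     (\<forall>Q'\<in>martingale_measures m. rel_entropy (prob\<^sub>m m) Q \<le> rel_entropy (prob\<^sub>m m) Q')"

text \<open>
  In all asymptotic notions the sequences are indexed by \<open>n \<ge> 1\<close>; the entry at \<open>0\<close> is irrelevant.
  The initial value of a wealth process is deterministic, so \<open>x n\<close> below is the constant value of \<open>X n 0\<close>.
\<close>

definition vanishing_initial :: "(nat \<Rightarrow> 'a market) \<Rightarrow> (nat \<Rightarrow> nat \<Rightarrow> 'a \<Rightarrow> real) \<Rightarrow> bool" where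
  "vanishing_initial m X \<longleftrightarrow>
     (\<exists>x. (\<forall>n\<ge>1. \<forall>\<omega>\<in>space (prob\<^sub>m (m n)). X n 0 \<omega> = x n) \<and> x \<longlonglongrightarrow> 0)"

definition success_prob :: "'a market \<Rightarrow> (nat \<Rightarrow> 'a \<Rightarrow> real) \<Rightarrow> real" where
  "success_prob m X = measure (prob\<^sub>m m) {\<omega> \<in> space (prob\<^sub>m m). 1 \<le> X (horizon\<^sub>m m) \<omega>}"

definition NAA :: "(nat \<Rightarrow> 'a market) \<Rightarrow> bool" where
  "NAA m \<longleftrightarrow>
     (\<forall>X. (\<forall>n\<ge>1. X n \<in> wealth_processes (m n)) \<longrightarrow> vanishing_initial m X \<longrightarrow>
        limsup (\<lambda>n. ereal (success_prob (m n) (X n))) = 0)"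

definition SAA :: "(nat \<Rightarrow> 'a market) \<Rightarrow> bool" where
  "SAA m \<longleftrightarrow>
     (\<exists>X. (\<forall>n\<ge>1. X n \<in> wealth_processes (m n)) \<and> vanishing_initial m X \<and>
        limsup (\<lambda>n. ereal (success_prob (m n) (X n))) = 1)"

definition contiguous :: "(nat \<Rightarrow> 'a measure) \<Rightarrow> (nat \<Rightarrow> 'a measure) \<Rightarrow> bool" where
  "contiguous P Q \<longleftrightarrow>
     (\<forall>A. (\<forall>n\<ge>1. A n \<in> sets (P n)) \<longrightarrow>
        (\<lambda>n. measure (Q n) (A n)) \<longlonglongrightarrow> 0 \<longrightarrow> (\<lambda>n. measure (P n) (A n)) \<longlonglongrightarrow> 0)"

definition entirely_separated :: "(nat \<Rightarrow> 'a measure) \<Rightarrow> (nat \<Rightarrow> 'a measure) \<Rightarrow> bool" where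
  "entirely_separated P Q \<longleftrightarrow>
     (\<exists>r A. strict_mono r \<and> (\<forall>k. 1 \<le> r k \<and> A (r k) \<in> sets (P (r k))) \<and>
        (\<lambda>k. measure (P (r k)) (A (r k))) \<longlonglongrightarrow> 1 \<and>
        (\<lambda>k. measure (Q (r k)) (A (r k))) \<longlonglongrightarrow> 0)"

end

theory Submission
  imports Defs
begin

text \<open>
  The minimal reverse entropy martingale measure \<open>Q\<close> is the one whose density is the reciprocal of
  attainable wealth: \<open>dP/dQ = V\<close>, where \<open>V = 1 + gains\<close> is the terminal value of a portfolio with
  initial capital 1. Such a portfolio is the log-optimal, or numeraire, portfolio, and everything
  else follows from this identity.

  \<^emph>\<open>Existence.\<close> A martingale measure is determined by its point masses, which range over a
  polytope cut out by finitely many linear equations, one for each increment of a stock over each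
  event known before it. Minimizing \<open>H(P|Q)\<close> means maximizing \<open>\<Prod> q powr p\<close>. By compactness the
  maximum over the closed polytope is attained, and the maximizer is strictly positive wherever
  \<open>P\<close> has mass because the product vanishes as soon as one such weight does. The first-order
  condition says that \<open>p/q\<close> is orthogonal to all directions of the polytope, hence lies in the
  span of the constraint functions. These are the constant 1 and the elementary gains, so \<open>p/q\<close> is
  a constant plus the gain of a predictable strategy (\<open>reverse_entropy_optimum_on_polytope\<close>,
  \<open>numeraire_pair_exists\<close>).

  \<^emph>\<open>Minimality and uniqueness.\<close> For a martingale measure \<open>R\<close>, the inequality \<open>ln x \<le> x - 1\<close> with
  \<open>x = dR/dQ\<close> gives \<open>H(P|R) - H(P|Q) \<ge> 1 - E\<^sub>P (dR/dQ) = 1 - E\<^sub>R V = 0\<close>, and equality forces \<open>R =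
  Q\<close> (\<open>numeraire_pair_min_reverse_entropy\<close>).

  \<^emph>\<open>Asymptotic arbitrage.\<close> Two estimates translate between wealth and events. On the one hand,
  \<open>Q(X\<^sub>T \<ge> 1) \<le> X\<^sub>0\<close> for every nonnegative wealth process \<open>X\<close>, so the success events of wealth
  processes with vanishing initial capital are asymptotically \<open>Q\<close>-negligible
  (\<open>martingale_measure_wealth_bound\<close>). On the other hand, since \<open>V\<close> is a density, \<open>P(A) \<le> c Q(A) +
  P(V \<ge> c)\<close>, and the last term is the success probability of the wealth process \<open>V/c\<close> with initial
  capital \<open>1/c\<close> (\<open>numeraire_wealth_test\<close>). If \<open>Q(A) \<rightarrow> 0\<close>, let \<open>c \<rightarrow> \<infinity>\<close> so slowly that \<open>c Q(A) \<rightarrow> 0\<close>: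
  the initial capital vanishes, and \<open>V/c\<close> succeeds asymptotically at least as often as \<open>A\<close> occurs.
\<close>

section \<open>Maximizing a weighted product over a polytope\<close>

text \<open>
  A Gram-Schmidt step: when \<open>b\<close> joins the family, the residual \<open>e\<close> of \<open>g b\<close> is orthogonal to the
  old span, and subtracting the component along \<open>e\<close> from the old residual of \<open>f\<close> makes it
  orthogonal to \<open>g b\<close> as well.
\<close>

lemma orthogonal_projection_on_finite_span:
  fixes g :: "'k \<Rightarrow> 'i \<Rightarrow> real" and f :: "'i \<Rightarrow> real"
  assumes "finite K" and "finite I"
  shows "\<exists>a. \<forall>k\<in>K. (\<Sum>i\<in>I. (f i - (\<Sum>l\<in>K. a l * g l i)) * g k i) = 0"
  using \<open>finite K\<close>
proof (induction K arbitrary: f rule: finite_induct)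
  case empty
  show ?case by simp
next
  case (insert b K)
  obtain c where c: "\<And>k. k \<in> K \<Longrightarrow> (\<Sum>i\<in>I. (g b i - (\<Sum>l\<in>K. c l * g l i)) * g k i) = 0"
    using insert.IH[of "g b"] by blast
  obtain a where a: "\<And>k. k \<in> K \<Longrightarrow> (\<Sum>i\<in>I. (f i - (\<Sum>l\<in>K. a l * g l i)) * g k i) = 0"
    using insert.IH[of f] by blast
  define e where "e i = g b i - (\<Sum>l\<in>K. c l * g l i)" for i
  define r where "r i = f i - (\<Sum>l\<in>K. a l * g l i)" for i
  define s where "s = (\<Sum>i\<in>I. r i * e i) / (\<Sum>i\<in>I. e i * e i)"
  define a' where "a' = (\<lambda>l. a l - s * c l)(b := s)"
  have res: "f i - (\<Sum>l\<in>insert b K. a' l * g l i) = r i - s * e i" for i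
  proof -
    have "(\<Sum>l\<in>insert b K. a' l * g l i) = s * g b i + (\<Sum>l\<in>K. a' l * g l i)"
      using insert.hyps by (simp add: a'_def)
    also have "(\<Sum>l\<in>K. a' l * g l i) = (\<Sum>l\<in>K. (a l - s * c l) * g l i)"
      by (rule sum.cong) (use insert.hyps in \<open>auto simp: a'_def\<close>)
    also have "\<dots> = (\<Sum>l\<in>K. a l * g l i) - s * (\<Sum>l\<in>K. c l * g l i)"
      by (simp add: left_diff_distrib sum_subtractf sum_distrib_left mult.assoc)
    finally show ?thesis
      unfolding r_def e_def by (simp add: algebra_simps)
  qed
  have eK: "(\<Sum>i\<in>I. (r i - s * e i) * g k i) = 0" if "k \<in> K" for k
  proof -
    have "(\<Sum>i\<in>I. (r i - s * e i) * g k i) = (\<Sum>i\<in>I. r i * g k i) - s * (\<Sum>i\<in>I. e i * g k i)"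
      by (simp add: left_diff_distrib sum_subtractf sum_distrib_left mult.assoc)
    then show ?thesis
      using a[OF that] c[OF that] unfolding r_def e_def by simp
  qed
  have se: "(\<Sum>i\<in>I. (r i - s * e i) * e i) = 0"
  proof -
    have eq: "(\<Sum>i\<in>I. (r i - s * e i) * e i) = (\<Sum>i\<in>I. r i * e i) - s * (\<Sum>i\<in>I. e i * e i)"
      by (simp add: left_diff_distrib sum_subtractf sum_distrib_left mult.assoc)
    \<comment> \<open>In the degenerate case \<open>s = 0\<close> by the convention for division by zero, which is harmless as
      \<open>e\<close> vanishes on \<open>I\<close>.\<close>
    show ?thesis
    proof (cases "(\<Sum>i\<in>I. e i * e i) = 0")
      case True
      then have "\<forall>i\<in>I. e i = 0"
        using \<open>finite I\<close> by (simp add: sum_nonneg_eq_0_iff)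
      then show ?thesis by simp
    next
      case False
      then have "s * (\<Sum>i\<in>I. e i * e i) = (\<Sum>i\<in>I. r i * e i)"
        unfolding s_def by simp
      then show ?thesis unfolding eq by simp
    qed
  qed
  have "(\<Sum>i\<in>I. (r i - s * e i) * g b i)
      = (\<Sum>i\<in>I. (r i - s * e i) * e i) + (\<Sum>i\<in>I. (r i - s * e i) * (\<Sum>l\<in>K. c l * g l i))"
    by (simp add: sum.distrib[symmetric] e_def algebra_simps)
  also have "(\<Sum>i\<in>I. (r i - s * e i) * (\<Sum>l\<in>K. c l * g l i))
      = (\<Sum>l\<in>K. c l * (\<Sum>i\<in>I. (r i - s * e i) * g l i))"
    unfolding sum_distrib_left by (subst sum.swap) (simp add: mult_ac)
  also have "\<dots> = 0" using eK by simp
  finally have eb: "(\<Sum>i\<in>I. (r i - s * e i) * g b i) = 0" using se by simp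
  show ?case
    by (rule exI[of _ a']) (use eK eb res in simp)
qed

text \<open>
  The residual of the projection of \<open>f\<close> is orthogonal to the family, hence to \<open>f\<close>, hence to
  itself, being \<open>f\<close> minus a combination of the family.
\<close>

lemma in_finite_span_if_orthogonal_to_complement:
  fixes g :: "'k \<Rightarrow> 'i \<Rightarrow> real" and f :: "'i \<Rightarrow> real"
  assumes K: "finite K" and I: "finite I"
    and orth: "\<And>Y. (\<And>k. k \<in> K \<Longrightarrow> (\<Sum>i\<in>I. Y i * g k i) = 0) \<Longrightarrow> (\<Sum>i\<in>I. Y i * f i) = 0"
  shows "\<exists>a. \<forall>i\<in>I. f i = (\<Sum>k\<in>K. a k * g k i)"
proof -
  obtain a where a: "\<And>k. k \<in> K \<Longrightarrow> (\<Sum>i\<in>I. (f i - (\<Sum>l\<in>K. a l * g l i)) * g k i) = 0"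
    using orthogonal_projection_on_finite_span[OF K I, of f g] by blast
  define Y where "Y i = f i - (\<Sum>l\<in>K. a l * g l i)" for i
  have Yg: "(\<Sum>i\<in>I. Y i * g k i) = 0" if "k \<in> K" for k
    using a[OF that] by (simp add: Y_def)
  have "(\<Sum>i\<in>I. Y i * Y i) = (\<Sum>i\<in>I. Y i * f i) - (\<Sum>i\<in>I. Y i * (\<Sum>l\<in>K. a l * g l i))"
    by (simp add: sum_subtractf[symmetric] Y_def algebra_simps)
  also have "(\<Sum>i\<in>I. Y i * (\<Sum>l\<in>K. a l * g l i)) = (\<Sum>l\<in>K. a l * (\<Sum>i\<in>I. Y i * g l i))"
    unfolding sum_distrib_left by (subst sum.swap) (simp add: mult_ac)
  also have "\<dots> = 0" using Yg by simp
  also have "(\<Sum>i\<in>I. Y i * f i) = 0" using orth Yg by blast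
  finally have "\<forall>i\<in>I. Y i = 0"
    using I by (simp add: sum_nonneg_eq_0_iff)
  then show ?thesis unfolding Y_def by (intro exI[of _ a]) simp
qed

text \<open>
  The vector \<open>q\<close> maximizes \<open>\<Prod> q powr w\<close> among the nonnegative vectors with the same moments as
  \<open>q0\<close>. The product replaces the sum \<open>\<Sum> w ln q\<close> because it stays continuous where a weight is
  zero. The constant function \<open>g b\<close> fixes the total mass and thereby makes the polytope bounded.
  The coefficients \<open>a\<close> are the Lagrange multipliers of the moment constraints.
\<close>

lemma reverse_entropy_optimum_on_polytope:
  fixes g :: "'k \<Rightarrow> 'i \<Rightarrow> real" and w q0 :: "'i \<Rightarrow> real"
  assumes K: "finite K" and I: "finite I"
    and w: "\<And>i. i \<in> I \<Longrightarrow> 0 < w i"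
    and q0: "\<And>i. i \<in> I \<Longrightarrow> 0 < q0 i"
    and one: "b \<in> K" "\<And>i. i \<in> I \<Longrightarrow> g b i = 1"
  shows "\<exists>q a. (\<forall>i\<in>I. 0 < q i \<and> w i / q i = (\<Sum>k\<in>K. a k * g k i)) \<and>
    (\<forall>k\<in>K. (\<Sum>i\<in>I. q i * g k i) = (\<Sum>i\<in>I. q0 i * g k i))"
proof -
  define c where "c = (\<Sum>i\<in>I. q0 i)"
  \<comment> \<open>Coordinates outside \<open>I\<close> are pinned to 0, so that Tychonoff applies to functions on the whole
    type.\<close>
  define D where "D = PiE UNIV (\<lambda>i. if i \<in> I then {0..c} else {0})
    \<inter> (\<Inter>k\<in>K. {q. (\<Sum>i\<in>I. q i * g k i) = (\<Sum>i\<in>I. q0 i * g k i)})"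
  define F where "F q = (\<Prod>i\<in>I. q i powr w i)" for q
  have "compactin (product_topology (\<lambda>i::'i. euclidean) UNIV)
      (PiE UNIV (\<lambda>i. if i \<in> I then {0..c} else {0}))"
    by (subst compactin_PiE) auto
  then have cB: "compact (PiE UNIV (\<lambda>i. if i \<in> I then {0..c} else {0}))"
    by (simp add: euclidean_product_topology)
  have "compact D"
    unfolding D_def
    by (rule compact_Int_closed[OF cB], rule closed_INT)
       (auto intro!: closed_Collect_eq continuous_intros continuous_on_product_coordinates)
  have memD: "q \<in> D \<longleftrightarrow> (\<forall>i. if i \<in> I then 0 \<le> q i \<and> q i \<le> c else q i = 0) \<and>
     (\<forall>k\<in>K. (\<Sum>i\<in>I. q i * g k i) = (\<Sum>i\<in>I. q0 i * g k i))" for q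
    unfolding D_def by (auto simp: PiE_iff split: if_splits)
  have inD: "q \<in> D" if nn: "\<And>i. i \<in> I \<Longrightarrow> 0 \<le> q i" and z: "\<And>i. i \<notin> I \<Longrightarrow> q i = 0"
    and m: "\<And>k. k \<in> K \<Longrightarrow> (\<Sum>i\<in>I. q i * g k i) = (\<Sum>i\<in>I. q0 i * g k i)" for q
  proof -
    have "(\<Sum>i\<in>I. q i) = c"
      using m[OF one(1)] one(2) unfolding c_def by simp
    then have "q i \<le> c" if "i \<in> I" for i
      using member_le_sum[of i I q] nn that I by auto
    then show ?thesis using nn z m unfolding memD by simp
  qed
  define p0 where "p0 i = (if i \<in> I then q0 i else 0)" for i
  have p0D: "p0 \<in> D"
    by (rule inD) (auto simp: p0_def less_imp_le[OF q0])
  have contF: "continuous_on D F"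
    unfolding F_def
    by (intro continuous_on_prod continuous_on_powr' continuous_on_const
        continuous_on_subset[OF continuous_on_product_coordinates])
       (auto simp: memD w dest: spec)
  obtain q where qD: "q \<in> D" and qmax: "\<And>y. y \<in> D \<Longrightarrow> F y \<le> F q"
    using continuous_attains_sup[OF \<open>compact D\<close> _ contF] p0D by blast
  have "0 < F p0"
    unfolding F_def by (rule prod_pos) (use q0 in \<open>auto simp: p0_def dest: less_imp_neq[OF q0]\<close>)
  also have "F p0 \<le> F q" by (rule qmax[OF p0D])
  finally have "\<forall>i\<in>I. q i powr w i \<noteq> 0"
    unfolding F_def using I by (metis less_irrefl prod_zero_iff)
  then have qpos: "0 < q i" if "i \<in> I" for i
    using qD that unfolding memD by (metis less_eq_real_def powr_0 that)
  have lnF: "F y = exp (\<Sum>i\<in>I. w i * ln (y i))" if "\<And>i. i \<in> I \<Longrightarrow> 0 < y i" for y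
    unfolding F_def exp_sum[OF I]
  proof (rule prod.cong[OF refl])
    fix i assume "i \<in> I"
    then show "y i powr w i = exp (w i * ln (y i))"
      using that[of i] by (simp add: powr_def)
  qed
  \<comment> \<open>Moving from \<open>q\<close> in a direction \<open>Y\<close> that preserves the moments stays in the polytope for small
    steps of either sign.\<close>
  have stationary: "(\<Sum>i\<in>I. Y i * (w i / q i)) = 0"
    if Y: "\<And>k. k \<in> K \<Longrightarrow> (\<Sum>i\<in>I. Y i * g k i) = 0" for Y
  proof -
    define \<phi> where "\<phi> t = (\<Sum>i\<in>I. w i * ln (q i + t * Y i))" for t
    have "\<forall>\<^sub>F t in at (0::real). \<forall>i\<in>I. 0 < q i + t * Y i"
    proof (rule eventually_ball_finite[OF I], rule ballI)
      fix i assume "i \<in> I"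
      have "((\<lambda>t. q i + t * Y i) \<longlongrightarrow> q i + 0 * Y i) (at 0)"
        by (intro tendsto_intros)
      then show "\<forall>\<^sub>F t in at 0. 0 < q i + t * Y i"
        using qpos[OF \<open>i \<in> I\<close>] by (intro order_tendstoD(1)[where y = "q i + 0 * Y i"]) auto
    qed
    then obtain d where d: "0 < d" "\<And>t. t \<noteq> 0 \<Longrightarrow> \<bar>t\<bar> < d \<Longrightarrow> \<forall>i\<in>I. 0 < q i + t * Y i"
      unfolding eventually_at by (auto simp: dist_real_def)
    have "\<phi> t \<le> \<phi> 0" if "\<bar>0 - t\<bar> < d" for t
    proof -
      have pos: "0 < q i + t * Y i" if "i \<in> I" for i
        using d(2)[of t] \<open>\<bar>0 - t\<bar> < d\<close> that qpos by (cases "t = 0") auto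
      define y where "y i = (if i \<in> I then q i + t * Y i else 0)" for i
      have "(\<Sum>i\<in>I. y i * g k i) = (\<Sum>i\<in>I. q0 i * g k i)" if "k \<in> K" for k
      proof -
        have "(\<Sum>i\<in>I. y i * g k i) = (\<Sum>i\<in>I. q i * g k i) + t * (\<Sum>i\<in>I. Y i * g k i)"
          by (simp add: y_def sum.distrib sum_distrib_left algebra_simps)
        then show ?thesis using Y[OF that] qD that unfolding memD by simp
      qed
      then have "y \<in> D"
        by (intro inD) (use pos in \<open>auto simp: y_def less_imp_le\<close>)
      then have "F y \<le> F q" by (rule qmax)
      then have "(\<Sum>i\<in>I. w i * ln (y i)) \<le> (\<Sum>i\<in>I. w i * ln (q i))"
        using pos qpos by (simp add: lnF y_def)
      then show ?thesis by (simp add: \<phi>_def y_def)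
    qed
    moreover have "DERIV \<phi> 0 :> (\<Sum>i\<in>I. Y i * (w i / q i))"
      unfolding \<phi>_def
      by (auto intro!: derivative_eq_intros sum.cong simp: qpos)
    ultimately show ?thesis
      using DERIV_local_max[of \<phi> _ 0 d] d(1) by blast
  qed
  obtain a where "\<forall>i\<in>I. w i / q i = (\<Sum>k\<in>K. a k * g k i)"
    using in_finite_span_if_orthogonal_to_complement[OF K I, of g "\<lambda>i. w i / q i"] stationary
    by blast
  then show ?thesis
    using qpos qD unfolding memD by blast
qed

section \<open>Probability measures on finite spaces\<close>

text \<open>
  The \<open>\<sigma>\<close>-algebra of a finite space need not contain all singletons. The mass of an atom is
  therefore spread evenly over its points, which yields weights with which all measures of events
  and all integrals of measurable functions are finite sums over points.
\<close>

definition atom_at :: "'a measure \<Rightarrow> 'a \<Rightarrow> 'a set" where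
  "atom_at M \<omega> = \<Inter>{A \<in> sets M. \<omega> \<in> A}"

definition point_mass :: "'a measure \<Rightarrow> 'a \<Rightarrow> real" where
  "point_mass M \<omega> = measure M (atom_at M \<omega>) / card (atom_at M \<omega>)"

definition charged_points :: "'a measure \<Rightarrow> 'a set" where
  "charged_points M = {\<omega> \<in> space M. 0 < point_mass M \<omega>}"

locale finite_prob_space = prob_space +
  assumes finite_space: "finite (space M)"
begin

lemma finite_sets: "finite (sets M)"
  by (rule finite_subset[OF sets.space_closed]) (simp add: finite_space)

lemma atom_at_in_sets:
  assumes "\<omega> \<in> space M"
  shows "atom_at M \<omega> \<in> sets M"
proof -
  have "(\<Inter>A\<in>{A \<in> sets M. \<omega> \<in> A}. A) \<in> sets M"
  proof (rule sets.finite_INT)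
    show "finite {A \<in> sets M. \<omega> \<in> A}"
      by (rule finite_subset[OF _ finite_sets]) blast
    have "space M \<in> {A \<in> sets M. \<omega> \<in> A}" using assms by simp
    then show "{A \<in> sets M. \<omega> \<in> A} \<noteq> {}" by (metis empty_iff)
  qed blast
  then show ?thesis by (simp add: atom_at_def)
qed

lemma self_in_atom_at: "\<omega> \<in> atom_at M \<omega>"
  by (auto simp: atom_at_def)

lemma atom_at_least: "A \<in> sets M \<Longrightarrow> \<omega> \<in> A \<Longrightarrow> atom_at M \<omega> \<subseteq> A"
  by (auto simp: atom_at_def)

lemma atom_at_subset_space: "\<omega> \<in> space M \<Longrightarrow> atom_at M \<omega> \<subseteq> space M"
  by (simp add: atom_at_least)

lemma finite_atom_at: "\<omega> \<in> space M \<Longrightarrow> finite (atom_at M \<omega>)"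
  by (rule finite_subset[OF atom_at_subset_space finite_space])

lemma atom_at_eq:
  assumes "\<omega> \<in> space M" and "\<omega>' \<in> atom_at M \<omega>"
  shows "atom_at M \<omega>' = atom_at M \<omega>"
proof -
  have \<omega>': "\<omega>' \<in> space M" using assms atom_at_subset_space by blast
  have 1: "atom_at M \<omega>' \<subseteq> atom_at M \<omega>"
    using atom_at_least[OF atom_at_in_sets[OF assms(1)] assms(2)] .
  have "\<omega> \<in> atom_at M \<omega>'"
  proof (rule ccontr)
    assume "\<omega> \<notin> atom_at M \<omega>'"
    then have "atom_at M \<omega> \<subseteq> space M - atom_at M \<omega>'"
      using assms(1) atom_at_in_sets[OF \<omega>'] by (intro atom_at_least) auto
    then show False using assms(2) self_in_atom_at[of \<omega>'] by auto
  qed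
  then have "atom_at M \<omega> \<subseteq> atom_at M \<omega>'"
    using atom_at_least[OF atom_at_in_sets[OF \<omega>']] by simp
  with 1 show ?thesis by (rule antisym)
qed

lemma measurable_const_on_atom:
  fixes f :: "'a \<Rightarrow> real"
  assumes f: "f \<in> borel_measurable M" and "\<omega> \<in> space M" and "\<omega>' \<in> atom_at M \<omega>"
  shows "f \<omega>' = f \<omega>"
proof -
  have "atom_at M \<omega> \<subseteq> f -` {f \<omega>} \<inter> space M"
    using measurable_sets[OF f, of "{f \<omega>}"] assms(2) by (intro atom_at_least) auto
  then show ?thesis using assms(3) by auto
qed

lemma measurable_if_const_on_atoms:
  fixes f :: "'a \<Rightarrow> real"
  assumes "\<And>\<omega> \<omega>'. \<omega> \<in> space M \<Longrightarrow> \<omega>' \<in> atom_at M \<omega> \<Longrightarrow> f \<omega>' = f \<omega>"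
  shows "f \<in> borel_measurable M"
proof (rule measurableI)
  fix S :: "real set"
  have "f -` S \<inter> space M = (\<Union>\<omega> \<in> f -` S \<inter> space M. atom_at M \<omega>)"
  proof (intro equalityI subsetI)
    fix \<omega>' assume "\<omega>' \<in> (\<Union>\<omega> \<in> f -` S \<inter> space M. atom_at M \<omega>)"
    then obtain \<omega> where "\<omega> \<in> space M" "f \<omega> \<in> S" "\<omega>' \<in> atom_at M \<omega>" by blast
    then show "\<omega>' \<in> f -` S \<inter> space M"
      using assms[of \<omega> \<omega>'] atom_at_subset_space[of \<omega>] by auto
  qed (use self_in_atom_at in blast)
  moreover have "(\<Union>\<omega> \<in> f -` S \<inter> space M. atom_at M \<omega>) \<in> sets M"
    using finite_space by (intro sets.finite_UN) (auto simp: atom_at_in_sets)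
  ultimately show "f -` S \<inter> space M \<in> sets M" by simp
qed simp

lemma point_mass_nonneg: "0 \<le> point_mass M \<omega>"
  by (simp add: point_mass_def)

lemma point_mass_const_on_atom:
  "\<omega> \<in> space M \<Longrightarrow> \<omega>' \<in> atom_at M \<omega> \<Longrightarrow> point_mass M \<omega>' = point_mass M \<omega>"
  by (simp add: point_mass_def atom_at_eq)

text \<open>
  An event is the disjoint union of the atoms of its points.
\<close>

lemma measure_eq_sum_point_mass:
  assumes A: "A \<in> sets M"
  shows "measure M A = (\<Sum>\<omega>\<in>A. point_mass M \<omega>)"
proof -
  have AS: "A \<subseteq> space M" using A sets.sets_into_space by blast
  then have finA: "finite A" using finite_space by (rule finite_subset)
  have fiber: "{\<omega> \<in> A. atom_at M \<omega> = B} = B" if "B \<in> atom_at M ` A" for B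
    using that AS atom_at_eq self_in_atom_at atom_at_least[OF A] by blast
  have disj: "disjoint_family_on (\<lambda>B. B) (atom_at M ` A)"
    unfolding disjoint_family_on_def using AS atom_at_eq by blast
  have "A = (\<Union>B\<in>atom_at M ` A. B)"
    using self_in_atom_at atom_at_least[OF A] by blast
  then have "measure M A = measure M (\<Union>B\<in>atom_at M ` A. B)" by simp
  also have "\<dots> = (\<Sum>B\<in>atom_at M ` A. measure M B)"
    by (rule finite_measure_finite_Union) (use finA AS disj atom_at_in_sets in auto)
  also have "\<dots> = (\<Sum>B\<in>atom_at M ` A. \<Sum>\<omega>\<in>{\<omega> \<in> A. atom_at M \<omega> = B}. point_mass M \<omega>)"
  proof (rule sum.cong[OF refl])
    fix B assume B: "B \<in> atom_at M ` A"
    then obtain \<omega>0 where \<omega>0: "\<omega>0 \<in> space M" "B = atom_at M \<omega>0" using AS by auto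
    have "(\<Sum>\<omega>\<in>B. point_mass M \<omega>) = (\<Sum>\<omega>\<in>B. point_mass M \<omega>0)"
      by (rule sum.cong) (use \<omega>0 point_mass_const_on_atom in auto)
    also have "\<dots> = measure M B"
      using \<omega>0 finite_atom_at[of \<omega>0] self_in_atom_at[of \<omega>0] by (auto simp: point_mass_def)
    finally show "measure M B = (\<Sum>\<omega>\<in>{\<omega> \<in> A. atom_at M \<omega> = B}. point_mass M \<omega>)"
      unfolding fiber[OF B] by simp
  qed
  also have "\<dots> = (\<Sum>\<omega>\<in>A. point_mass M \<omega>)"
    using sum.image_gen[OF finA, of "point_mass M" "atom_at M"] by simp
  finally show ?thesis .
qed

lemma sum_point_mass: "(\<Sum>\<omega>\<in>space M. point_mass M \<omega>) = 1"
  using measure_eq_sum_point_mass[of "space M"] prob_space by simp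

lemma integrable_on_finite_space:
  fixes f :: "'a \<Rightarrow> real"
  assumes "f \<in> borel_measurable M"
  shows "integrable M f"
proof (rule integrable_const_bound[where B = "Max (insert 0 ((\<lambda>\<omega>. \<bar>f \<omega>\<bar>) ` space M))"])
  show "AE \<omega> in M. norm (f \<omega>) \<le> Max (insert 0 ((\<lambda>\<omega>. \<bar>f \<omega>\<bar>) ` space M))"
    using finite_space by (intro AE_I2) (auto intro!: Max_ge)
qed fact

lemma integral_eq_sum_point_mass:
  fixes f :: "'a \<Rightarrow> real"
  assumes f[measurable]: "f \<in> borel_measurable M"
  shows "(\<integral>\<omega>. f \<omega> \<partial>M) = (\<Sum>\<omega>\<in>space M. point_mass M \<omega> * f \<omega>)"
proof -
  define L where "L y = f -` {y} \<inter> space M" for y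
  have L[measurable]: "L y \<in> sets M" for y by (simp add: L_def)
  have "(\<integral>\<omega>. f \<omega> \<partial>M) = (\<integral>\<omega>. (\<Sum>y\<in>f ` space M. y * indicator (L y) \<omega>) \<partial>M)"
  proof (rule Bochner_Integration.integral_cong[OF refl])
    fix \<omega> assume "\<omega> \<in> space M"
    then have "(\<Sum>y\<in>f ` space M. y * indicator (L y) \<omega>)
        = (\<Sum>y\<in>f ` space M. if y = f \<omega> then y else 0)"
      by (intro sum.cong) (auto simp: L_def)
    then show "f \<omega> = (\<Sum>y\<in>f ` space M. y * indicator (L y) \<omega>)"
      using finite_space \<open>\<omega> \<in> space M\<close> by simp
  qed
  also have "\<dots> = (\<Sum>y\<in>f ` space M. y * measure M (L y))"
    by (subst Bochner_Integration.integral_sum)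
       (auto intro!: integrable_on_finite_space)
  also have "\<dots> = (\<Sum>y\<in>f ` space M. \<Sum>\<omega>\<in>{\<omega> \<in> space M. f \<omega> = y}. point_mass M \<omega> * f \<omega>)"
  proof (rule sum.cong[OF refl])
    fix y
    have "L y = {\<omega> \<in> space M. f \<omega> = y}" by (auto simp: L_def)
    then show "y * measure M (L y) = (\<Sum>\<omega>\<in>{\<omega> \<in> space M. f \<omega> = y}. point_mass M \<omega> * f \<omega>)"
      unfolding measure_eq_sum_point_mass[OF L] by (simp add: sum_distrib_left mult.commute)
  qed
  also have "\<dots> = (\<Sum>\<omega>\<in>space M. point_mass M \<omega> * f \<omega>)"
    using sum.image_gen[OF finite_space, of "\<lambda>\<omega>. point_mass M \<omega> * f \<omega>" f] by simp
  finally show ?thesis .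
qed

lemma sum_charged_points:
  "(\<Sum>\<omega>\<in>space M. point_mass M \<omega> * f \<omega>) = (\<Sum>\<omega>\<in>charged_points M. point_mass M \<omega> * f \<omega>)"
proof (rule sum.mono_neutral_right[OF finite_space])
  show "\<forall>\<omega>\<in>space M - charged_points M. point_mass M \<omega> * f \<omega> = 0"
    using point_mass_nonneg by (auto simp: charged_points_def not_less intro: antisym)
qed (auto simp: charged_points_def)

text \<open>
  A null set contains with each of its points the whole atom, so it misses the charged points, and
  the points that carry no mass form a measurable null set.
\<close>

lemma AE_iff_charged_points: "(AE \<omega> in M. \<phi> \<omega>) \<longleftrightarrow> (\<forall>\<omega>\<in>charged_points M. \<phi> \<omega>)"
proof
  assume "AE \<omega> in M. \<phi> \<omega>"
  then obtain N where N: "{\<omega> \<in> space M. \<not> \<phi> \<omega>} \<subseteq> N" "N \<in> sets M" "emeasure M N = 0"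
    by (auto elim: AE_E)
  show "\<forall>\<omega>\<in>charged_points M. \<phi> \<omega>"
  proof (rule ballI, rule ccontr)
    fix \<omega> assume \<omega>: "\<omega> \<in> charged_points M" and "\<not> \<phi> \<omega>"
    then have "\<omega> \<in> N" using N(1) by (auto simp: charged_points_def)
    moreover have "finite N"
      by (rule finite_subset[OF sets.sets_into_space[OF N(2)] finite_space])
    moreover have "(\<Sum>\<omega>\<in>N. point_mass M \<omega>) = 0"
      using N(3) measure_eq_sum_point_mass[OF N(2)] by (simp add: measure_def)
    ultimately have "point_mass M \<omega> = 0"
      by (simp add: sum_nonneg_eq_0_iff point_mass_nonneg)
    then show False using \<omega> by (simp add: charged_points_def)
  qed
next
  assume *: "\<forall>\<omega>\<in>charged_points M. \<phi> \<omega>"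
  define N where "N = space M - charged_points M"
  have N: "N \<in> sets M"
  proof -
    have "point_mass M \<in> borel_measurable M"
      by (rule measurable_if_const_on_atoms) (rule point_mass_const_on_atom)
    then show ?thesis unfolding N_def charged_points_def by measurable
  qed
  have "measure M N = 0"
    unfolding measure_eq_sum_point_mass[OF N]
    by (rule sum.neutral)
       (use point_mass_nonneg in \<open>auto simp: N_def charged_points_def not_less intro: antisym\<close>)
  then have "N \<in> null_sets M"
    using N by (simp add: emeasure_eq_measure null_setsI)
  then show "AE \<omega> in M. \<phi> \<omega>"
    by (rule AE_I') (use * in \<open>auto simp: N_def\<close>)
qed

end

lemma atom_at_cong: "sets M = sets N \<Longrightarrow> atom_at M = atom_at N"
  by (simp add: atom_at_def fun_eq_iff)

text \<open>
  Equivalent measures have the same events, hence the same atoms, and charge the same points.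
  Relative to these points all densities and entropies are ratios and sums of point masses.
\<close>

locale equivalent_finite_prob_spaces =
  P: finite_prob_space P + Q: finite_prob_space Q for P Q :: "'a measure" +
  assumes equiv: "equivalent_measures P Q"
begin

lemma sets_eq: "sets Q = sets P"
  using equiv by (simp add: equivalent_measures_def)

lemma space_eq: "space Q = space P"
  using sets_eq by (rule sets_eq_imp_space_eq)

lemma atom_at_eq: "atom_at Q = atom_at P"
  using sets_eq by (rule atom_at_cong)

lemma charged_points_eq: "charged_points Q = charged_points P"
proof -
  have "0 < measure P (atom_at P \<omega>) \<longleftrightarrow> 0 < measure Q (atom_at P \<omega>)" if "\<omega> \<in> space P" for \<omega>
  proof -
    have "atom_at P \<omega> \<in> null_sets P \<longleftrightarrow> atom_at P \<omega> \<in> null_sets Q"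
      using equiv by (auto simp: equivalent_measures_def absolutely_continuous_def)
    then show ?thesis
      using P.atom_at_in_sets[OF that]
      by (simp add: null_sets_def sets_eq P.emeasure_eq_measure Q.emeasure_eq_measure
          zero_less_measure_iff)
  qed
  moreover have "0 < card (atom_at P \<omega>)" if "\<omega> \<in> space P" for \<omega>
    using that P.finite_atom_at P.self_in_atom_at by (auto simp: card_gt_0_iff)
  ultimately show ?thesis
    by (auto simp: charged_points_def point_mass_def atom_at_eq space_eq zero_less_divide_iff)
qed

lemma RN_deriv_eq_ratio:
  "AE \<omega> in P. enn2real (RN_deriv Q P \<omega>) = point_mass P \<omega> / point_mass Q \<omega>"
proof -
  define f where "f \<omega> = point_mass P \<omega> / point_mass Q \<omega>" for \<omega>
  have fnn: "0 \<le> f \<omega>" for \<omega>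
    by (simp add: f_def P.point_mass_nonneg Q.point_mass_nonneg)
  have f[measurable]: "f \<in> borel_measurable Q"
    unfolding f_def
    by (rule Q.measurable_if_const_on_atoms)
       (metis P.point_mass_const_on_atom Q.point_mass_const_on_atom atom_at_eq space_eq)
  have "density Q (\<lambda>\<omega>. ennreal (f \<omega>)) = P"
  proof (rule measure_eqI)
    fix A assume "A \<in> sets (density Q (\<lambda>\<omega>. ennreal (f \<omega>)))"
    then have A[measurable]: "A \<in> sets Q" by simp
    have "emeasure (density Q (\<lambda>\<omega>. ennreal (f \<omega>))) A
        = (\<integral>\<^sup>+\<omega>. ennreal (f \<omega> * indicator A \<omega>) \<partial>Q)"
      by (subst emeasure_density) (auto intro!: nn_integral_cong simp: indicator_def)
    also have "\<dots> = ennreal (\<integral>\<omega>. f \<omega> * indicator A \<omega> \<partial>Q)"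
      by (rule nn_integral_eq_integral) (auto intro!: Q.integrable_on_finite_space simp: fnn)
    also have "(\<integral>\<omega>. f \<omega> * indicator A \<omega> \<partial>Q)
        = (\<Sum>\<omega>\<in>charged_points P. point_mass Q \<omega> * (f \<omega> * indicator A \<omega>))"
      using charged_points_eq
      by (subst Q.integral_eq_sum_point_mass) (auto simp: Q.sum_charged_points)
    also have "\<dots> = (\<Sum>\<omega>\<in>charged_points P. point_mass P \<omega> * indicator A \<omega>)"
      by (rule sum.cong[OF refl], fold charged_points_eq) (simp add: f_def charged_points_def)
    also have "\<dots> = (\<integral>\<omega>. indicator A \<omega> \<partial>P)"
      using A sets_eq by (subst P.integral_eq_sum_point_mass) (auto simp: P.sum_charged_points)
    also have "\<dots> = measure P A"
      using A sets_eq by simp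
    finally show "emeasure (density Q (\<lambda>\<omega>. ennreal (f \<omega>))) A = emeasure P A"
      by (simp add: P.emeasure_eq_measure)
  qed (simp add: sets_eq)
  then have "AE \<omega> in Q. ennreal (f \<omega>) = RN_deriv Q P \<omega>"
    by (intro Q.RN_deriv_unique) auto
  then show ?thesis
    unfolding P.AE_iff_charged_points Q.AE_iff_charged_points charged_points_eq
    by (metis enn2real_ennreal f_def fnn)
qed

lemma rel_entropy_eq_sum:
  "rel_entropy P Q
    = (\<Sum>\<omega>\<in>charged_points P. point_mass P \<omega> * ln (point_mass P \<omega> / point_mass Q \<omega>))"
proof -
  have [measurable]: "entropy_density (exp 1) Q P \<in> borel_measurable P"
    using measurable_entropy_density[of "exp 1" Q P] by (simp add: measurable_cong_sets[OF sets_eq refl])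
  have "rel_entropy P Q = (\<Sum>\<omega>\<in>charged_points P. point_mass P \<omega> * entropy_density (exp 1) Q P \<omega>)"
    unfolding rel_entropy_def KL_divergence_def
    by (simp add: P.integral_eq_sum_point_mass P.sum_charged_points)
  also have "\<dots> = (\<Sum>\<omega>\<in>charged_points P. point_mass P \<omega> * ln (point_mass P \<omega> / point_mass Q \<omega>))"
    by (rule sum.cong)
       (use RN_deriv_eq_ratio in \<open>auto simp: P.AE_iff_charged_points entropy_density_def log_def\<close>)
  finally show ?thesis .
qed

end

text \<open>
  This realizes \<open>V\<close> as \<open>dP/dQ\<close>. Positivity is only demanded at charged points, so the density \<open>1 /
  V\<close> may have meaningless values on a null set.
\<close>

lemma (in finite_prob_space) equivalent_prob_with_inverse_density:
  fixes V :: "'a \<Rightarrow> real"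
  assumes V[measurable]: "V \<in> borel_measurable M"
    and pos: "\<And>\<omega>. \<omega> \<in> charged_points M \<Longrightarrow> 0 < V \<omega>"
    and one: "(\<integral>\<omega>. 1 / V \<omega> \<partial>M) = 1"
  obtains Q where "prob_space Q" "equivalent_measures M Q"
    "\<And>f :: 'a \<Rightarrow> real. f \<in> borel_measurable M \<Longrightarrow> (\<integral>\<omega>. f \<omega> \<partial>Q) = (\<integral>\<omega>. f \<omega> / V \<omega> \<partial>M)"
proof -
  define Q where "Q = density M (\<lambda>\<omega>. ennreal (1 / V \<omega>))"
  have AEpos: "AE \<omega> in M. 0 < V \<omega>"
    using pos by (simp add: AE_iff_charged_points)
  have int: "(\<integral>\<omega>. f \<omega> \<partial>Q) = (\<integral>\<omega>. f \<omega> / V \<omega> \<partial>M)" if "f \<in> borel_measurable M" for f :: "'a \<Rightarrow> real"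
    unfolding Q_def using that AEpos by (subst integral_density) auto
  have "emeasure Q (space Q) = (\<integral>\<^sup>+\<omega>. ennreal (1 / V \<omega>) \<partial>M)"
    by (simp add: Q_def emeasure_density cong: nn_integral_cong)
  also have "\<dots> = ennreal (\<integral>\<omega>. 1 / V \<omega> \<partial>M)"
    by (rule nn_integral_eq_integral) (use AEpos in \<open>auto intro!: integrable_on_finite_space\<close>)
  finally have "prob_space Q" using one by (intro prob_spaceI) simp
  moreover have "equivalent_measures M Q"
    unfolding equivalent_measures_def
  proof (intro conjI)
    show "sets Q = sets M" by (simp add: Q_def)
    show "absolutely_continuous M Q"
      unfolding Q_def by (rule absolutely_continuousI_density) simp
    have "A \<in> null_sets M" if "A \<in> null_sets Q" for A
    proof -
      have z: "AE \<omega> in M. \<omega> \<in> A \<longrightarrow> ennreal (1 / V \<omega>) = 0" and A: "A \<in> sets M"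
        using that unfolding Q_def by (auto simp: null_sets_density_iff)
      from z AEpos have "AE \<omega> in M. \<omega> \<notin> A"
        by eventually_elim (auto simp: ennreal_eq_0_iff)
      then show ?thesis using A by (simp add: AE_iff_null_sets)
    qed
    then show "absolutely_continuous Q M"
      unfolding absolutely_continuous_def by blast
  qed
  ultimately show thesis using that int by blast
qed

section \<open>The numeraire portfolio of a finite market\<close>

definition price_increment :: "'a market \<Rightarrow> nat \<Rightarrow> nat \<Rightarrow> 'a \<Rightarrow> real" where
  "price_increment m j i \<omega> = price\<^sub>m m j i \<omega> - price\<^sub>m m (j - 1) i \<omega>"

locale market_model =
  fixes m :: "'a market"
  assumes market: "finite_market m"

sublocale market_model \<subseteq> finite_prob_space "prob\<^sub>m m"
  using market by (simp add: finite_market_def finite_prob_space_def finite_prob_space_axioms_def)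

context market_model
begin

abbreviation "P \<equiv> prob\<^sub>m m"
abbreviation "T \<equiv> horizon\<^sub>m m"
abbreviation "F \<equiv> info\<^sub>m m"

lemma subalgebra_info: "t \<le> T \<Longrightarrow> subalgebra P (F t)"
  using market by (simp add: finite_market_def)

lemma measurable_info_imp: "t \<le> T \<Longrightarrow> f \<in> borel_measurable (F t) \<Longrightarrow> f \<in> borel_measurable P"
  using subalgebra_info measurable_from_subalg by blast

lemma measurable_info_mono:
  "s \<le> t \<Longrightarrow> t \<le> T \<Longrightarrow> f \<in> borel_measurable (F s) \<Longrightarrow> f \<in> borel_measurable (F t)"
  using market measurable_from_subalg unfolding finite_market_def by blast

lemma sets_info_mono: "s \<le> t \<Longrightarrow> t \<le> T \<Longrightarrow> A \<in> sets (F s) \<Longrightarrow> A \<in> sets (F t)"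
  using market unfolding finite_market_def subalgebra_def by blast

lemma sets_info_imp: "t \<le> T \<Longrightarrow> A \<in> sets (F t) \<Longrightarrow> A \<in> sets P"
  using subalgebra_info unfolding subalgebra_def by blast

lemma space_info: "t \<le> T \<Longrightarrow> space (F t) = space P"
  using subalgebra_info unfolding subalgebra_def by blast

lemma price_measurable:
  "t \<le> T \<Longrightarrow> i \<in> {1..dim\<^sub>m m} \<Longrightarrow> price\<^sub>m m t i \<in> borel_measurable (F t)"
  using market unfolding finite_market_def by blast

lemma price_increment_measurable:
  assumes "j \<in> {1..T}" "i \<in> {1..dim\<^sub>m m}"
  shows "price_increment m j i \<in> borel_measurable (F j)"
proof -
  have j: "j \<le> T" "j - 1 \<le> T" "j - 1 \<le> j" using assms by auto
  have "price\<^sub>m m j i \<in> borel_measurable (F j)"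
    by (rule price_measurable[OF j(1) assms(2)])
  moreover have "price\<^sub>m m (j - 1) i \<in> borel_measurable (F j)"
    by (rule measurable_info_mono[OF j(3,1) price_measurable[OF j(2) assms(2)]])
  ultimately show ?thesis
    unfolding price_increment_def[abs_def] by measurable
qed

lemma gains_eq: "gains m \<gamma> t \<omega> = (\<Sum>j=1..t. \<Sum>i=1..dim\<^sub>m m. \<gamma> j i \<omega> * price_increment m j i \<omega>)"
  by (simp add: gains_def price_increment_def)

lemma gains_measurable:
  assumes \<gamma>: "predictable m \<gamma>" and t: "t \<le> T"
  shows "gains m \<gamma> t \<in> borel_measurable (F t)"
  unfolding gains_eq[abs_def]
proof (intro borel_measurable_sum borel_measurable_times)
  fix j i assume j: "j \<in> {1..t}" and i: "i \<in> {1..dim\<^sub>m m}"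
  then have jT: "j \<in> {1..T}" using t by simp
  show "\<gamma> j i \<in> borel_measurable (F t)"
  proof (rule measurable_info_mono[OF _ t])
    show "j - 1 \<le> t" using j by auto
    show "\<gamma> j i \<in> borel_measurable (F (j - 1))"
      using \<gamma> jT i unfolding predictable_def by blast
  qed
  show "price_increment m j i \<in> borel_measurable (F t)"
    using price_increment_measurable[OF jT i] measurable_info_mono[of j t] j t by simp
qed

lemma equivalent_if_martingale_measure:
  assumes "Q \<in> martingale_measures m"
  shows "equivalent_finite_prob_spaces P Q"
proof -
  have Q: "prob_space Q" "equivalent_measures P Q"
    using assms by (auto simp: martingale_measures_def)
  moreover have "space Q = space P"
    using Q(2) by (auto simp: equivalent_measures_def dest: sets_eq_imp_space_eq)
  ultimately show ?thesis
    using finite_space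
    by (auto simp: equivalent_finite_prob_spaces_def equivalent_finite_prob_spaces_axioms_def
        finite_prob_space_def finite_prob_space_axioms_def finite_prob_space_axioms
        intro: prob_space_axioms)
qed

lemma subalgebra_info_equivalent: "sets Q = sets P \<Longrightarrow> t \<le> T \<Longrightarrow> subalgebra Q (F t)"
  using subalgebra_info[of t] sets_eq_imp_space_eq[of Q P] by (simp add: subalgebra_def)

text \<open>
  Together with its converse below, this replaces the conditional expectations in the martingale
  property by finitely many linear equations for \<open>Q\<close>: those with \<open>h\<close> the indicator of an event at
  time \<open>j - 1\<close>.
\<close>

lemma martingale_measure_orthogonal:
  assumes Q: "Q \<in> martingale_measures m" and j: "j \<in> {1..T}" and i: "i \<in> {1..dim\<^sub>m m}"
    and h: "h \<in> borel_measurable (F (j - 1))"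
  shows "(\<integral>\<omega>. h \<omega> * price_increment m j i \<omega> \<partial>Q) = 0"
proof -
  interpret equivalent_finite_prob_spaces P Q by (rule equivalent_if_martingale_measure[OF Q])
  have jT: "j \<le> T" "j - 1 \<le> T" using j by auto
  interpret C: finite_measure_subalgebra Q "F (j - 1)"
    using subalgebra_info_equivalent[OF sets_eq jT(2)] by unfold_locales
  have meas_Q: "f \<in> borel_measurable Q" if "f \<in> borel_measurable P" for f :: "'a \<Rightarrow> real"
    using that measurable_cong_sets[OF sets_eq refl] by blast
  have S: "price\<^sub>m m j i \<in> borel_measurable Q" "price\<^sub>m m (j - 1) i \<in> borel_measurable Q"
    "h \<in> borel_measurable Q"
    using price_measurable[OF jT(1) i] price_measurable[OF jT(2) i] h jT measurable_info_imp meas_Q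
    by blast+
  have hS: "integrable Q (\<lambda>\<omega>. h \<omega> * price\<^sub>m m j i \<omega>)" "integrable Q (\<lambda>\<omega>. h \<omega> * price\<^sub>m m (j - 1) i \<omega>)"
    using S by (auto intro!: Q.integrable_on_finite_space)
  have ce: "AE \<omega> in Q. real_cond_exp Q (F (j - 1)) (price\<^sub>m m j i) \<omega> = price\<^sub>m m (j - 1) i \<omega>"
    using Q i jT unfolding martingale_measures_def martingale_upto_def by force
  have "(\<integral>\<omega>. h \<omega> * price\<^sub>m m j i \<omega> \<partial>Q)
      = (\<integral>\<omega>. h \<omega> * real_cond_exp Q (F (j - 1)) (price\<^sub>m m j i) \<omega> \<partial>Q)"
    by (rule C.real_cond_exp_intg(2)[symmetric]) (use hS h S in auto)
  also have "\<dots> = (\<integral>\<omega>. h \<omega> * price\<^sub>m m (j - 1) i \<omega> \<partial>Q)"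
    by (rule integral_cong_AE)
       (use ce S C.real_cond_exp_intg(1)[OF hS(1) h S(1)] in auto)
  finally show ?thesis
    using hS by (simp add: price_increment_def right_diff_distrib)
qed

text \<open>
  Gains from trading after time \<open>t\<close> have zero \<open>Q\<close>-mean on any event known at time \<open>t\<close>. Strategies
  are bounded on a finite space, so gains are true martingales.
\<close>

lemma integral_gains_on_past_event:
  assumes Q: "Q \<in> martingale_measures m" and \<gamma>: "predictable m \<gamma>"
    and t: "t \<le> T" and A: "A \<in> sets (F t)"
  shows "(\<integral>\<omega>. indicator A \<omega> * gains m \<gamma> T \<omega> \<partial>Q) = (\<integral>\<omega>. indicator A \<omega> * gains m \<gamma> t \<omega> \<partial>Q)"
proof -
  interpret equivalent_finite_prob_spaces P Q by (rule equivalent_if_martingale_measure[OF Q])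
  have meas_Q: "f \<in> borel_measurable Q" if "s \<le> T" "f \<in> borel_measurable (F s)" for f :: "'a \<Rightarrow> real" and s
    using measurable_info_imp[OF that] measurable_cong_sets[OF sets_eq refl] by blast
  define D where "D j \<omega> = (\<Sum>i=1..dim\<^sub>m m. indicator A \<omega> * \<gamma> j i \<omega> * price_increment m j i \<omega>)" for j \<omega>
  have summand: "integrable Q (\<lambda>\<omega>. indicator A \<omega> * \<gamma> j i \<omega> * price_increment m j i \<omega>)
      \<and> (\<integral>\<omega>. indicator A \<omega> * \<gamma> j i \<omega> * price_increment m j i \<omega> \<partial>Q) = 0"
    if j: "j \<in> {t<..T}" and i: "i \<in> {1..dim\<^sub>m m}" for j i
  proof -
    have jT: "j \<in> {1..T}" using j by auto
    have h: "(\<lambda>\<omega>. indicator A \<omega> * \<gamma> j i \<omega>) \<in> borel_measurable (F (j - 1))"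
      using \<gamma> jT i j sets_info_mono[of t "j - 1" A] A
      by (intro borel_measurable_times borel_measurable_indicator) (auto simp: predictable_def)
    moreover have "(\<lambda>\<omega>. indicator A \<omega> * \<gamma> j i \<omega>) \<in> borel_measurable Q"
      "price_increment m j i \<in> borel_measurable Q"
      using meas_Q[OF _ h] meas_Q[OF _ price_increment_measurable[OF jT i]] jT by auto
    ultimately show ?thesis
      using martingale_measure_orthogonal[OF Q jT i h]
      by (auto intro!: Q.integrable_on_finite_space)
  qed
  have intD: "integrable Q (\<lambda>\<omega>. indicator A \<omega> * gains m \<gamma> s \<omega>)" if "s \<le> T" for s
  proof (rule Q.integrable_on_finite_space, rule borel_measurable_times)
    show "indicator A \<in> borel_measurable Q"
      using sets_info_imp[OF t A] sets_eq by simp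
    show "gains m \<gamma> s \<in> borel_measurable Q"
      using meas_Q[OF that gains_measurable[OF \<gamma> that]] .
  qed
  have eq: "indicator A \<omega> * gains m \<gamma> T \<omega> - indicator A \<omega> * gains m \<gamma> t \<omega> = (\<Sum>j\<in>{t<..T}. D j \<omega>)" for \<omega>
  proof -
    have "{1..T} = {1..t} \<union> {t<..T}" using t by auto
    moreover have "{1..t} \<inter> {t<..T} = {}" by auto
    ultimately have "gains m \<gamma> T \<omega> = gains m \<gamma> t \<omega>
        + (\<Sum>j\<in>{t<..T}. \<Sum>i=1..dim\<^sub>m m. \<gamma> j i \<omega> * price_increment m j i \<omega>)"
      unfolding gains_eq by (simp only: sum.union_disjoint finite_atLeastAtMost finite_greaterThanAtMost)
    then show ?thesis
      by (simp add: D_def sum_distrib_left algebra_simps)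
  qed
  have "(\<integral>\<omega>. indicator A \<omega> * gains m \<gamma> T \<omega> \<partial>Q) - (\<integral>\<omega>. indicator A \<omega> * gains m \<gamma> t \<omega> \<partial>Q)
      = (\<integral>\<omega>. (\<Sum>j\<in>{t<..T}. D j \<omega>) \<partial>Q)"
    unfolding eq[symmetric] using intD t by (subst Bochner_Integration.integral_diff) auto
  also have "\<dots> = (\<Sum>j\<in>{t<..T}. \<Sum>i=1..dim\<^sub>m m.
      (\<integral>\<omega>. indicator A \<omega> * \<gamma> j i \<omega> * price_increment m j i \<omega> \<partial>Q))"
    unfolding D_def using summand
    by (subst Bochner_Integration.integral_sum; (intro sum.cong Bochner_Integration.integral_sum refl)?)
       (auto intro!: Bochner_Integration.integrable_sum)
  also have "\<dots> = 0" using summand by (intro sum.neutral ballI) blast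
  finally show ?thesis by simp
qed

lemma integral_gains_eq_0:
  assumes Q: "Q \<in> martingale_measures m" and \<gamma>: "predictable m \<gamma>"
  shows "(\<integral>\<omega>. gains m \<gamma> T \<omega> \<partial>Q) = 0"
proof -
  interpret equivalent_finite_prob_spaces P Q by (rule equivalent_if_martingale_measure[OF Q])
  have "space P \<in> sets (F 0)"
    using sets.top[of "F 0"] by (simp add: space_info)
  from integral_gains_on_past_event[OF Q \<gamma> _ this]
  have "(\<integral>\<omega>. indicator (space P) \<omega> * gains m \<gamma> T \<omega> \<partial>Q) = 0"
    by (simp add: gains_def)
  moreover have "(\<integral>\<omega>. indicator (space P) \<omega> * gains m \<gamma> T \<omega> \<partial>Q) = (\<integral>\<omega>. gains m \<gamma> T \<omega> \<partial>Q)"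
    by (rule Bochner_Integration.integral_cong) (simp_all add: space_eq)
  ultimately show ?thesis by simp
qed

text \<open>
  One-step orthogonality telescopes to increments over any time interval, because an event at time
  \<open>s\<close> is known at all later times. This characterizes the conditional expectation.
\<close>

lemma martingale_measure_if_orthogonal:
  assumes Q: "prob_space Q" "equivalent_measures P Q"
    and orth: "\<And>j i A. j \<in> {1..T} \<Longrightarrow> i \<in> {1..dim\<^sub>m m} \<Longrightarrow> A \<in> sets (F (j - 1)) \<Longrightarrow>
      (\<integral>\<omega>. indicator A \<omega> * price_increment m j i \<omega> \<partial>Q) = 0"
  shows "Q \<in> martingale_measures m"
proof -
  have sets_eq: "sets Q = sets P" using Q(2) by (simp add: equivalent_measures_def)
  have space_eq: "space Q = space P" using sets_eq by (rule sets_eq_imp_space_eq)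
  interpret Q: finite_prob_space Q
    using Q(1) finite_space space_eq
    by (simp add: finite_prob_space_def finite_prob_space_axioms_def)
  have meas_Q: "f \<in> borel_measurable Q" if "s \<le> T" "f \<in> borel_measurable (F s)" for f :: "'a \<Rightarrow> real" and s
    using measurable_info_imp[OF that] measurable_cong_sets[OF sets_eq refl] by blast
  have "martingale_upto T F Q (\<lambda>t. price\<^sub>m m t i)" if i: "i \<in> {1..dim\<^sub>m m}" for i
    unfolding martingale_upto_def
  proof (intro conjI allI impI)
    fix t assume t: "t \<le> T"
    show "price\<^sub>m m t i \<in> borel_measurable (F t)" by (rule price_measurable[OF t i])
    then show int_t: "integrable Q (price\<^sub>m m t i)"
      by (intro Q.integrable_on_finite_space meas_Q[OF t])
    fix s assume s: "s \<le> t"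
    then have sT: "s \<le> T" using t by simp
    interpret C: finite_measure_subalgebra Q "F s"
      using subalgebra_info_equivalent[OF sets_eq sT] by unfold_locales
    have ms: "price\<^sub>m m s i \<in> borel_measurable (F s)" by (rule price_measurable[OF sT i])
    show "AE \<omega> in Q. real_cond_exp Q (F s) (price\<^sub>m m t i) \<omega> = price\<^sub>m m s i \<omega>"
    proof (rule C.real_cond_exp_charact)
      show "integrable Q (price\<^sub>m m t i)" by (rule int_t)
      show "integrable Q (price\<^sub>m m s i)"
        using meas_Q[OF sT ms] by (rule Q.integrable_on_finite_space)
      show "price\<^sub>m m s i \<in> borel_measurable (F s)" by (rule ms)
      fix A assume A: "A \<in> sets (F s)"
      have intA: "integrable Q (\<lambda>\<omega>. indicator A \<omega> * f \<omega>)" if "f \<in> borel_measurable Q" for f :: "'a \<Rightarrow> real"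
        using that sets_info_imp[OF sT A] sets_eq
        by (intro Q.integrable_on_finite_space borel_measurable_times) auto
      have tele: "price\<^sub>m m t i \<omega> - price\<^sub>m m s i \<omega> = (\<Sum>j\<in>{s<..t}. price_increment m j i \<omega>)" for \<omega>
        using s
      proof (induction t rule: dec_induct)
        case (step n)
        have "{s<..Suc n} = insert (Suc n) {s<..n}" using step.hyps by auto
        then show ?case using step.IH by (simp add: price_increment_def)
      qed simp
      have "(\<integral>\<omega>. indicator A \<omega> * price\<^sub>m m t i \<omega> \<partial>Q) - (\<integral>\<omega>. indicator A \<omega> * price\<^sub>m m s i \<omega> \<partial>Q)
          = (\<integral>\<omega>. indicator A \<omega> * price\<^sub>m m t i \<omega> - indicator A \<omega> * price\<^sub>m m s i \<omega> \<partial>Q)"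
        using intA meas_Q[OF sT ms] meas_Q[OF t price_measurable[OF t i]]
        by (subst Bochner_Integration.integral_diff) auto
      also have "\<dots> = (\<integral>\<omega>. (\<Sum>j\<in>{s<..t}. indicator A \<omega> * price_increment m j i \<omega>) \<partial>Q)"
        by (simp add: right_diff_distrib[symmetric] tele sum_distrib_left)
      also have "\<dots> = (\<Sum>j\<in>{s<..t}. (\<integral>\<omega>. indicator A \<omega> * price_increment m j i \<omega> \<partial>Q))"
        using t by (intro Bochner_Integration.integral_sum intA)
          (auto intro!: meas_Q[OF _ price_increment_measurable[OF _ i]])
      also have "\<dots> = 0"
        using t by (intro sum.neutral ballI orth i sets_info_mono[OF _ _ A]) auto
      finally show "(\<integral>\<omega>\<in>A. price\<^sub>m m t i \<omega> \<partial>Q) = (\<integral>\<omega>\<in>A. price\<^sub>m m s i \<omega> \<partial>Q)"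
        by (simp add: set_lebesgue_integral_def)
    qed
  qed
  then show ?thesis using Q by (simp add: martingale_measures_def)
qed

definition terminal_value :: "(nat \<Rightarrow> nat \<Rightarrow> 'a \<Rightarrow> real) \<Rightarrow> 'a \<Rightarrow> real" where
  "terminal_value \<gamma> \<omega> = 1 + gains m \<gamma> T \<omega>"

lemma terminal_value_measurable: "predictable m \<gamma> \<Longrightarrow> terminal_value \<gamma> \<in> borel_measurable P"
  using measurable_info_imp[OF _ gains_measurable[of \<gamma> T]]
  unfolding terminal_value_def[abs_def] by simp

text \<open>
  The identity \<open>dP/dQ = V\<close>, multiplied out and restricted to the points that carry mass.
\<close>

definition numeraire_pair :: "(nat \<Rightarrow> nat \<Rightarrow> 'a \<Rightarrow> real) \<Rightarrow> 'a measure \<Rightarrow> bool" where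
  "numeraire_pair \<gamma> Q \<longleftrightarrow> predictable m \<gamma> \<and> Q \<in> martingale_measures m \<and>
     (\<forall>\<omega>\<in>charged_points P. point_mass P \<omega> = point_mass Q \<omega> * terminal_value \<gamma> \<omega>)"

text \<open>
  The linear constraints on the point masses of a martingale measure are indexed by triples \<open>(j,
  i, A)\<close>, for the increment of stock \<open>i\<close> at time \<open>j\<close> over the event \<open>A\<close>, with \<open>None\<close> for the total
  mass. The multipliers at \<open>(j, i, A)\<close> assemble into a predictable strategy, and the multiplier at
  \<open>None\<close> is its initial capital.
\<close>

lemma numeraire_pair_exists:
  assumes "martingale_measures m \<noteq> {}"
  shows "\<exists>\<gamma> Q. numeraire_pair \<gamma> Q"
proof -
  obtain Q0 where Q0: "Q0 \<in> martingale_measures m" using assms by blast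
  interpret E: equivalent_finite_prob_spaces P Q0 by (rule equivalent_if_martingale_measure[OF Q0])
  define I where "I = charged_points P"
  define J where "J = (SIGMA j:{1..T}. {1..dim\<^sub>m m} \<times> sets (F (j - 1)))"
  define K where "K = insert None (Some ` J)"
  define g where "g k = (case k of None \<Rightarrow> (\<lambda>\<omega>. 1)
      | Some (j, i, A) \<Rightarrow> (\<lambda>\<omega>. indicator A \<omega> * price_increment m j i \<omega>))"
    for k :: "(nat \<times> nat \<times> 'a set) option"
  have fin_info: "finite (sets (F (j - 1)))" if "j \<in> {1..T}" for j
    by (rule finite_subset[OF _ finite_sets]) (use sets_info_imp[of "j - 1"] that in auto)
  have finJ: "finite J"
    unfolding J_def by (intro finite_SigmaI finite_cartesian_product fin_info) auto
  have finK: "finite K" by (simp add: K_def finJ)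
  have finI: "finite I"
    unfolding I_def charged_points_def using finite_space by simp
  have "\<exists>q a. (\<forall>\<omega>\<in>I. 0 < q \<omega> \<and> point_mass P \<omega> / q \<omega> = (\<Sum>k\<in>K. a k * g k \<omega>)) \<and>
    (\<forall>k\<in>K. (\<Sum>\<omega>\<in>I. q \<omega> * g k \<omega>) = (\<Sum>\<omega>\<in>I. point_mass Q0 \<omega> * g k \<omega>))"
  proof (rule reverse_entropy_optimum_on_polytope[OF finK finI, where b = None])
    show "0 < point_mass P \<omega>" if "\<omega> \<in> I" for \<omega>
      using that by (simp add: I_def charged_points_def)
    show "0 < point_mass Q0 \<omega>" if "\<omega> \<in> I" for \<omega>
      using that unfolding I_def E.charged_points_eq[symmetric] by (simp add: charged_points_def)
  qed (simp_all add: K_def g_def)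
  then obtain q a where qpos: "\<And>\<omega>. \<omega> \<in> I \<Longrightarrow> 0 < q \<omega>"
    and ratio: "\<And>\<omega>. \<omega> \<in> I \<Longrightarrow> point_mass P \<omega> / q \<omega> = (\<Sum>k\<in>K. a k * g k \<omega>)"
    and mom: "\<And>k. k \<in> K \<Longrightarrow> (\<Sum>\<omega>\<in>I. q \<omega> * g k \<omega>) = (\<Sum>\<omega>\<in>I. point_mass Q0 \<omega> * g k \<omega>)"
    by blast
  define \<gamma> where "\<gamma> j i \<omega> = (\<Sum>A\<in>sets (F (j - 1)). a (Some (j, i, A)) * indicator A \<omega>)" for j i \<omega>
  define V where "V \<omega> = a None + gains m \<gamma> T \<omega>" for \<omega>
  have \<gamma>: "predictable m \<gamma>"
    unfolding predictable_def \<gamma>_def[abs_def]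
    by (intro ballI borel_measurable_sum borel_measurable_times borel_measurable_const
        borel_measurable_indicator)
  have V: "V \<in> borel_measurable P"
    unfolding V_def[abs_def] using measurable_info_imp[OF _ gains_measurable[OF \<gamma>]] by simp
  have span: "(\<Sum>k\<in>K. a k * g k \<omega>) = V \<omega>" for \<omega>
  proof -
    have "(\<Sum>k\<in>K. a k * g k \<omega>) = a None + (\<Sum>k\<in>J. a (Some k) * g (Some k) \<omega>)"
      unfolding K_def using finJ by (subst sum.insert) (auto simp: g_def sum.reindex)
    also have "(\<Sum>k\<in>J. a (Some k) * g (Some k) \<omega>) = (\<Sum>j\<in>{1..T}. \<Sum>i\<in>{1..dim\<^sub>m m}.
        \<Sum>A\<in>sets (F (j - 1)). a (Some (j, i, A)) * (indicator A \<omega> * price_increment m j i \<omega>))"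
    proof -
      have "(\<Sum>k\<in>J. a (Some k) * g (Some k) \<omega>)
          = (\<Sum>(j, k)\<in>J. a (Some (j, k)) * g (Some (j, k)) \<omega>)"
        by (simp add: case_prod_unfold)
      also have "\<dots> = (\<Sum>j\<in>{1..T}. \<Sum>k\<in>{1..dim\<^sub>m m} \<times> sets (F (j - 1)).
          a (Some (j, k)) * g (Some (j, k)) \<omega>)"
        unfolding J_def
        by (rule sum.Sigma[symmetric]) (use fin_info in \<open>auto intro!: finite_cartesian_product\<close>)
      also have "\<dots> = (\<Sum>j\<in>{1..T}. \<Sum>i\<in>{1..dim\<^sub>m m}. \<Sum>A\<in>sets (F (j - 1)).
          a (Some (j, i, A)) * g (Some (j, i, A)) \<omega>)"
        by (simp add: sum.cartesian_product case_prod_unfold)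
      finally show ?thesis by (simp add: g_def)
    qed
    also have "\<dots> = gains m \<gamma> T \<omega>"
      unfolding gains_eq \<gamma>_def by (simp add: sum_distrib_right mult.assoc)
    finally show ?thesis by (simp add: V_def)
  qed
  have ratioV: "point_mass P \<omega> / V \<omega> = q \<omega>" and Vpos: "0 < V \<omega>" if "\<omega> \<in> I" for \<omega>
  proof -
    have p: "0 < point_mass P \<omega>" using that by (simp add: I_def charged_points_def)
    have eq: "V \<omega> = point_mass P \<omega> / q \<omega>"
      using span ratio[OF that] by simp
    show "0 < V \<omega>" unfolding eq using p qpos[OF that] by simp
    show "point_mass P \<omega> / V \<omega> = q \<omega>" unfolding eq using p by simp
  qed
  have int: "(\<integral>\<omega>. f \<omega> / V \<omega> \<partial>P) = (\<Sum>\<omega>\<in>I. q \<omega> * f \<omega>)" if f: "f \<in> borel_measurable P" for f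
  proof -
    have "(\<integral>\<omega>. f \<omega> / V \<omega> \<partial>P) = (\<Sum>\<omega>\<in>I. point_mass P \<omega> * (f \<omega> / V \<omega>))"
      unfolding I_def sum_charged_points[symmetric]
      by (rule integral_eq_sum_point_mass) (intro borel_measurable_divide f V)
    also have "\<dots> = (\<Sum>\<omega>\<in>I. q \<omega> * f \<omega>)"
      by (rule sum.cong) (simp_all flip: ratioV)
    finally show ?thesis .
  qed
  have int0: "(\<integral>\<omega>. f \<omega> \<partial>Q0) = (\<Sum>\<omega>\<in>I. point_mass Q0 \<omega> * f \<omega>)" if f: "f \<in> borel_measurable P" for f
    unfolding I_def E.charged_points_eq[symmetric] E.Q.sum_charged_points[symmetric]
    by (rule E.Q.integral_eq_sum_point_mass) (use f measurable_cong_sets[OF E.sets_eq refl] in blast)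
  have "(\<Sum>\<omega>\<in>I. q \<omega>) = 1"
    using mom[of None] int0[of "\<lambda>\<omega>. 1"] E.Q.prob_space by (simp add: K_def g_def)
  then have one: "(\<integral>\<omega>. 1 / V \<omega> \<partial>P) = 1"
    using int[of "\<lambda>\<omega>. 1"] by simp
  obtain Q where Q: "prob_space Q" "equivalent_measures P Q"
    and intQ: "\<And>f :: 'a \<Rightarrow> real. f \<in> borel_measurable P \<Longrightarrow> (\<integral>\<omega>. f \<omega> \<partial>Q) = (\<integral>\<omega>. f \<omega> / V \<omega> \<partial>P)"
    using equivalent_prob_with_inverse_density[OF V _ one] Vpos unfolding I_def by blast
  have QM: "Q \<in> martingale_measures m"
  proof (rule martingale_measure_if_orthogonal[OF Q])
    fix j i A assume j: "j \<in> {1..T}" and i: "i \<in> {1..dim\<^sub>m m}" and A: "A \<in> sets (F (j - 1))"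
    let ?f = "\<lambda>\<omega>. indicator A \<omega> * price_increment m j i \<omega>"
    have f: "?f \<in> borel_measurable P"
      using j i A sets_info_imp[of "j - 1" A] measurable_info_imp[OF _ price_increment_measurable[OF j i]]
      by (intro borel_measurable_times borel_measurable_indicator) auto
    have "Some (j, i, A) \<in> K" using j i A by (auto simp: K_def J_def)
    from mom[OF this] have "(\<Sum>\<omega>\<in>I. q \<omega> * ?f \<omega>) = (\<Sum>\<omega>\<in>I. point_mass Q0 \<omega> * ?f \<omega>)"
      by (simp add: g_def)
    also have "\<dots> = 0"
      using int0[OF f] martingale_measure_orthogonal[OF Q0 j i] A by simp
    finally show "(\<integral>\<omega>. ?f \<omega> \<partial>Q) = 0"
      using intQ[OF f] int[OF f] by simp
  qed
  interpret EQ: equivalent_finite_prob_spaces P Q by (rule equivalent_if_martingale_measure[OF QM])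
  have "(\<integral>\<omega>. V \<omega> \<partial>Q) = a None"
  proof -
    have "gains m \<gamma> T \<in> borel_measurable Q"
      using measurable_info_imp[OF _ gains_measurable[OF \<gamma>]] measurable_cong_sets[OF EQ.sets_eq refl]
      by blast
    then show ?thesis
      unfolding V_def using integral_gains_eq_0[OF QM \<gamma>] EQ.Q.prob_space
      by (simp add: EQ.Q.integrable_on_finite_space)
  qed
  \<comment> \<open>The initial capital is the \<open>Q\<close>-mean of \<open>V = dP/dQ\<close>, which is the total mass of \<open>P\<close>.\<close>
  moreover have "(\<integral>\<omega>. V \<omega> \<partial>Q) = (\<Sum>\<omega>\<in>I. point_mass P \<omega>)"
    unfolding intQ[OF V] int[OF V]
    by (rule sum.cong[OF refl]) (use Vpos in \<open>force simp flip: ratioV\<close>)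
  moreover have "(\<Sum>\<omega>\<in>I. point_mass P \<omega>) = 1"
    using sum_charged_points[of "\<lambda>\<omega>. 1"] sum_point_mass by (simp add: I_def)
  ultimately have aNone: "a None = 1" by simp
  have "point_mass P \<omega> = point_mass Q \<omega> * V \<omega>" if \<omega>: "\<omega> \<in> I" for \<omega>
  proof -
    have \<omega>s: "\<omega> \<in> space P" using \<omega> by (simp add: I_def charged_points_def)
    let ?A = "atom_at P \<omega>"
    have A: "?A \<in> sets P" by (rule atom_at_in_sets[OF \<omega>s])
    have "measure Q ?A = (\<integral>\<omega>'. indicator ?A \<omega>' \<partial>Q)"
      using A EQ.sets_eq by simp
    also have "\<dots> = (\<integral>\<omega>'. indicator ?A \<omega>' / V \<omega>' \<partial>P)"
      by (rule intQ) (use A in simp)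
    also have "\<dots> = (\<integral>\<omega>'. indicator ?A \<omega>' / V \<omega> \<partial>P)"
      by (rule Bochner_Integration.integral_cong)
         (use measurable_const_on_atom[OF V \<omega>s] in \<open>auto simp: indicator_def\<close>)
    also have "\<dots> = measure P ?A / V \<omega>"
      using A by simp
    finally have "measure P ?A = measure Q ?A * V \<omega>"
      using Vpos[OF \<omega>] by (simp add: field_simps)
    then show ?thesis by (simp add: point_mass_def EQ.atom_at_eq)
  qed
  then have "numeraire_pair \<gamma> Q"
    using \<gamma> QM by (simp add: numeraire_pair_def terminal_value_def V_def aNone I_def)
  then show ?thesis by blast
qed

lemma sum_terminal_value:
  assumes \<gamma>: "predictable m \<gamma>" and Q: "Q \<in> martingale_measures m"
  shows "(\<Sum>\<omega>\<in>charged_points P. point_mass Q \<omega> * terminal_value \<gamma> \<omega>) = 1"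
proof -
  interpret equivalent_finite_prob_spaces P Q by (rule equivalent_if_martingale_measure[OF Q])
  have V: "terminal_value \<gamma> \<in> borel_measurable Q" "gains m \<gamma> T \<in> borel_measurable Q"
    using terminal_value_measurable[OF \<gamma>] measurable_info_imp[OF _ gains_measurable[OF \<gamma>]]
      measurable_cong_sets[OF sets_eq refl] by blast+
  have "(\<integral>\<omega>. terminal_value \<gamma> \<omega> \<partial>Q) = 1"
    unfolding terminal_value_def using integral_gains_eq_0[OF Q \<gamma>] V(2) Q.prob_space
    by (simp add: Q.integrable_on_finite_space)
  then show ?thesis
    using V(1)
    by (simp add: Q.integral_eq_sum_point_mass Q.sum_charged_points charged_points_eq)
qed

lemma measure_eq_if_point_mass_eq:
  assumes Q: "Q \<in> martingale_measures m" and Q': "Q' \<in> martingale_measures m"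
    and eq: "\<And>\<omega>. \<omega> \<in> charged_points P \<Longrightarrow> point_mass Q' \<omega> = point_mass Q \<omega>"
  shows "Q' = Q"
proof -
  interpret E: equivalent_finite_prob_spaces P Q by (rule equivalent_if_martingale_measure[OF Q])
  interpret E': equivalent_finite_prob_spaces P Q' by (rule equivalent_if_martingale_measure[OF Q'])
  have "point_mass Q' \<omega> = point_mass Q \<omega>" if "\<omega> \<in> space P" for \<omega>
  proof (cases "\<omega> \<in> charged_points P")
    case False
    then have "\<omega> \<notin> charged_points Q" "\<omega> \<notin> charged_points Q'"
      using E.charged_points_eq E'.charged_points_eq by auto
    then have "point_mass Q \<omega> \<le> 0" "point_mass Q' \<omega> \<le> 0"
      using that E.space_eq E'.space_eq by (auto simp: charged_points_def not_less)
    then show ?thesis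
      using E.Q.point_mass_nonneg[of \<omega>] E'.Q.point_mass_nonneg[of \<omega>] by simp
  qed (rule eq)
  then have "measure Q' A = measure Q A" if "A \<in> sets P" for A
    using that sets.sets_into_space[OF that] E.sets_eq E'.sets_eq
    by (auto simp: E.Q.measure_eq_sum_point_mass E'.Q.measure_eq_sum_point_mass intro!: sum.cong)
  then show ?thesis
    using E.sets_eq E'.sets_eq
    by (intro measure_eqI) (auto simp: E.Q.emeasure_eq_measure E'.Q.emeasure_eq_measure)
qed

text \<open>
  With \<open>p, q, r\<close> the point masses of \<open>P, Q, R\<close>, the entropy difference \<open>\<Sum> p ln (q/r)\<close> equals the
  sum of the nonnegative terms \<open>\<delta> = p (r/q - 1 - ln (r/q))\<close> plus \<open>1 - \<Sum> r V\<close>, and the last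
  difference vanishes because \<open>V\<close> has \<open>R\<close>-mean 1 under every martingale measure \<open>R\<close>.
\<close>

lemma numeraire_pair_min_reverse_entropy:
  assumes VQ: "numeraire_pair \<gamma> Q"
  shows "min_reverse_entropy_mm m Q' \<longleftrightarrow> Q' = Q"
proof -
  have \<gamma>: "predictable m \<gamma>" and Q: "Q \<in> martingale_measures m"
    and V: "\<And>\<omega>. \<omega> \<in> charged_points P \<Longrightarrow> point_mass P \<omega> = point_mass Q \<omega> * terminal_value \<gamma> \<omega>"
    using VQ by (auto simp: numeraire_pair_def)
  interpret E: equivalent_finite_prob_spaces P Q by (rule equivalent_if_martingale_measure[OF Q])
  have *: "rel_entropy P Q \<le> rel_entropy P R \<and> (rel_entropy P R \<le> rel_entropy P Q \<longrightarrow> R = Q)"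
    if R: "R \<in> martingale_measures m" for R
  proof -
    interpret ER: equivalent_finite_prob_spaces P R by (rule equivalent_if_martingale_measure[OF R])
    let ?p = "point_mass P" and ?q = "point_mass Q" and ?r = "point_mass R"
    define \<delta> where "\<delta> \<omega> = ?p \<omega> * (?r \<omega> / ?q \<omega> - 1 - ln (?r \<omega> / ?q \<omega>))" for \<omega>
    have pos: "0 < ?p \<omega>" "0 < ?q \<omega>" "0 < ?r \<omega>" if "\<omega> \<in> charged_points P" for \<omega>
      using that E.charged_points_eq ER.charged_points_eq by (auto simp: charged_points_def)
    have nonneg: "0 \<le> \<delta> \<omega>" if "\<omega> \<in> charged_points P" for \<omega>
      using pos[OF that] ln_le_minus_one[of "?r \<omega> / ?q \<omega>"] by (simp add: \<delta>_def)
    have "?p \<omega> * ln (?p \<omega> / ?r \<omega>) - ?p \<omega> * ln (?p \<omega> / ?q \<omega>)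
        = \<delta> \<omega> + ?p \<omega> * 1 - ?r \<omega> * terminal_value \<gamma> \<omega>" if "\<omega> \<in> charged_points P" for \<omega>
    proof -
      have "?p \<omega> / ?q \<omega> = terminal_value \<gamma> \<omega>" using V[OF that] pos[OF that] by simp
      then have "?p \<omega> * (?r \<omega> / ?q \<omega>) = ?r \<omega> * terminal_value \<gamma> \<omega>"
        by (metis mult.commute times_divide_eq_left)
      then show ?thesis
        using pos[OF that] by (simp add: \<delta>_def ln_div algebra_simps)
    qed
    then have "rel_entropy P R - rel_entropy P Q
        = (\<Sum>\<omega>\<in>charged_points P. \<delta> \<omega> + ?p \<omega> * 1 - ?r \<omega> * terminal_value \<gamma> \<omega>)"
      unfolding E.rel_entropy_eq_sum ER.rel_entropy_eq_sum sum_subtractf[symmetric]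
      by (intro sum.cong) auto
    also have "\<dots> = (\<Sum>\<omega>\<in>charged_points P. \<delta> \<omega>)"
      using sum_terminal_value[OF \<gamma> R] sum_charged_points[of "\<lambda>\<omega>. 1"] sum_point_mass
      by (simp add: sum.distrib sum_subtractf)
    finally have diff: "rel_entropy P R - rel_entropy P Q = (\<Sum>\<omega>\<in>charged_points P. \<delta> \<omega>)" .
    have "R = Q" if "rel_entropy P R \<le> rel_entropy P Q"
    proof (rule measure_eq_if_point_mass_eq[OF Q R])
      fix \<omega> assume \<omega>: "\<omega> \<in> charged_points P"
      have "finite (charged_points P)"
        using finite_space by (simp add: charged_points_def)
      moreover have "(\<Sum>\<omega>\<in>charged_points P. \<delta> \<omega>) = 0"
        using that diff sum_nonneg[of "charged_points P" \<delta>] nonneg by force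
      ultimately have "\<delta> \<omega> = 0"
        using \<omega> nonneg by (simp add: sum_nonneg_eq_0_iff)
      then have "?r \<omega> / ?q \<omega> = 1"
        using pos[OF \<omega>] ln_eq_minus_one[of "?r \<omega> / ?q \<omega>"] by (simp add: \<delta>_def)
      then show "?r \<omega> = ?q \<omega>" using pos[OF \<omega>] by simp
    qed
    then show ?thesis
      using diff sum_nonneg[of "charged_points P" \<delta>] nonneg by auto
  qed
  then show ?thesis
    using Q unfolding min_reverse_entropy_mm_def by blast
qed

text \<open>
  Markov's inequality for the nonnegative variable \<open>X\<^sub>T\<close>, whose \<open>Q\<close>-mean is the initial capital.
\<close>

lemma martingale_measure_wealth_bound:
  assumes Q: "Q \<in> martingale_measures m" and X: "X \<in> wealth_processes m"
    and X0: "\<And>\<omega>. \<omega> \<in> space P \<Longrightarrow> X 0 \<omega> = x"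
  shows "{\<omega> \<in> space P. 1 \<le> X T \<omega>} \<in> sets P" and "measure Q {\<omega> \<in> space P. 1 \<le> X T \<omega>} \<le> x"
proof -
  interpret E: equivalent_finite_prob_spaces P Q by (rule equivalent_if_martingale_measure[OF Q])
  obtain y \<gamma> where \<gamma>: "predictable m \<gamma>"
    and Xt: "\<And>t \<omega>. t \<le> T \<Longrightarrow> \<omega> \<in> space P \<Longrightarrow> X t \<omega> = y + gains m \<gamma> t \<omega>"
    and nn: "AE \<omega> in P. 0 \<le> X T \<omega>"
    using X by (auto simp: wealth_processes_def)
  have "y = x"
    using not_empty Xt[of 0] X0 by (force simp: gains_def)
  define Y where "Y \<omega> = x + gains m \<gamma> T \<omega>" for \<omega>
  have XY: "X T \<omega> = Y \<omega>" if "\<omega> \<in> space P" for \<omega>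
    using Xt[of T] that \<open>y = x\<close> by (simp add: Y_def)
  have G: "gains m \<gamma> T \<in> borel_measurable P"
    using measurable_info_imp[OF _ gains_measurable[OF \<gamma>]] by simp
  then have Y: "Y \<in> borel_measurable P" unfolding Y_def[abs_def] by simp
  let ?B = "{\<omega> \<in> space P. 1 \<le> X T \<omega>}"
  have B: "?B = {\<omega> \<in> space P. 1 \<le> Y \<omega>}" using XY by auto
  show Bs: "?B \<in> sets P" unfolding B using Y by measurable
  have YQ: "Y \<in> borel_measurable Q" "gains m \<gamma> T \<in> borel_measurable Q"
    using Y G measurable_cong_sets[OF E.sets_eq refl] by blast+
  have "AE \<omega> in P. indicator ?B \<omega> \<le> Y \<omega>"
    using nn unfolding AE_iff_charged_points
    by (auto simp: indicator_def charged_points_def XY)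
  then have le: "AE \<omega> in Q. indicator ?B \<omega> \<le> Y \<omega>"
    unfolding AE_iff_charged_points E.Q.AE_iff_charged_points E.charged_points_eq .
  have "measure Q ?B = (\<integral>\<omega>. indicator ?B \<omega> \<partial>Q)"
    using Bs E.sets_eq by simp
  also have "\<dots> \<le> (\<integral>\<omega>. Y \<omega> \<partial>Q)"
    using le Bs YQ E.sets_eq
    by (intro integral_mono_AE E.Q.integrable_on_finite_space) auto
  also have "\<dots> = x"
    unfolding Y_def using integral_gains_eq_0[OF Q \<gamma>] YQ(2) E.Q.prob_space
    by (simp add: E.Q.integrable_on_finite_space)
  finally show "measure Q ?B \<le> x" .
qed

text \<open>
  The terminal value is positive, and the value at time \<open>t\<close> is its conditional \<open>Q\<close>-expectation.
  Concretely, on the event \<open>A\<close> that the value at time \<open>t\<close> is negative it has the same \<open>Q\<close>-integral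
  as the terminal value, so \<open>A\<close> carries no mass.
\<close>

lemma numeraire_wealth_nonneg:
  assumes VQ: "numeraire_pair \<gamma> Q" and t: "t \<le> T"
  shows "AE \<omega> in P. 0 \<le> 1 + gains m \<gamma> t \<omega>"
proof -
  have \<gamma>: "predictable m \<gamma>" and Q: "Q \<in> martingale_measures m"
    and V: "\<And>\<omega>. \<omega> \<in> charged_points P \<Longrightarrow> point_mass P \<omega> = point_mass Q \<omega> * terminal_value \<gamma> \<omega>"
    using VQ by (auto simp: numeraire_pair_def)
  interpret E: equivalent_finite_prob_spaces P Q by (rule equivalent_if_martingale_measure[OF Q])
  let ?I = "charged_points P" and ?q = "point_mass Q"
  define W where "W \<omega> = 1 + gains m \<gamma> t \<omega>" for \<omega>
  define A where "A = {\<omega> \<in> space P. W \<omega> < 0}"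
  have "W \<in> borel_measurable (F t)"
    unfolding W_def[abs_def] using gains_measurable[OF \<gamma> t] by simp
  then have A: "A \<in> sets (F t)"
    unfolding A_def space_info[OF t, symmetric] by measurable
  have sum_eq: "(\<integral>\<omega>. indicator A \<omega> * f \<omega> \<partial>Q) = (\<Sum>\<omega>\<in>?I. ?q \<omega> * (indicator A \<omega> * f \<omega>))"
    and int: "integrable Q (\<lambda>\<omega>. indicator A \<omega> * f \<omega>)"
    if "f \<in> borel_measurable P" for f
  proof -
    have [measurable]: "f \<in> borel_measurable Q" "A \<in> sets Q"
      using that measurable_cong_sets[OF E.sets_eq refl] sets_info_imp[OF t A] E.sets_eq by blast+
    show "(\<integral>\<omega>. indicator A \<omega> * f \<omega> \<partial>Q) = (\<Sum>\<omega>\<in>?I. ?q \<omega> * (indicator A \<omega> * f \<omega>))"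
      by (subst E.Q.integral_eq_sum_point_mass)
         (simp_all add: E.Q.sum_charged_points E.charged_points_eq)
    show "integrable Q (\<lambda>\<omega>. indicator A \<omega> * f \<omega>)"
      by (rule E.Q.integrable_on_finite_space) measurable
  qed
  have G: "gains m \<gamma> s \<in> borel_measurable P" if "s \<le> T" for s
    using measurable_info_imp[OF that gains_measurable[OF \<gamma> that]] .
  have "0 \<le> (\<Sum>\<omega>\<in>?I. ?q \<omega> * (indicator A \<omega> * terminal_value \<gamma> \<omega>))"
  proof (rule sum_nonneg)
    fix \<omega> assume "\<omega> \<in> ?I"
    then have "0 \<le> ?q \<omega> * terminal_value \<gamma> \<omega>"
      using V point_mass_nonneg[of \<omega>] by simp
    then show "0 \<le> ?q \<omega> * (indicator A \<omega> * terminal_value \<gamma> \<omega>)"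
      by (simp add: indicator_def)
  qed
  also have "\<dots> = (\<integral>\<omega>. indicator A \<omega> * terminal_value \<gamma> \<omega> \<partial>Q)"
    by (rule sum_eq[symmetric]) (rule terminal_value_measurable[OF \<gamma>])
  also have "\<dots> = (\<integral>\<omega>. indicator A \<omega> * W \<omega> \<partial>Q)"
    using integral_gains_on_past_event[OF Q \<gamma> t A] int[OF G[OF order_refl]] int[OF G[OF t]] int[of "\<lambda>\<omega>. 1"]
    by (simp add: terminal_value_def W_def distrib_left)
  also have "\<dots> = (\<Sum>\<omega>\<in>?I. ?q \<omega> * (indicator A \<omega> * W \<omega>))"
    by (rule sum_eq) (use G[OF t] in \<open>simp add: W_def[abs_def]\<close>)
  finally have "0 \<le> (\<Sum>\<omega>\<in>?I. ?q \<omega> * (indicator A \<omega> * W \<omega>))" .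
  moreover have qpos: "0 < ?q \<omega>" if "\<omega> \<in> ?I" for \<omega>
    using that E.charged_points_eq by (auto simp: charged_points_def)
  have nonpos: "?q \<omega> * (indicator A \<omega> * W \<omega>) \<le> 0" if "\<omega> \<in> ?I" for \<omega>
    using qpos[OF that] by (auto simp: indicator_def A_def mult_le_0_iff)
  moreover have "finite ?I" using finite_space by (simp add: charged_points_def)
  ultimately have "?q \<omega> * (indicator A \<omega> * W \<omega>) = 0" if "\<omega> \<in> ?I" for \<omega>
    using sum_nonpos[of ?I "\<lambda>\<omega>. ?q \<omega> * (indicator A \<omega> * W \<omega>)"]
      sum_nonneg_eq_0_iff[of ?I "\<lambda>\<omega>. - (?q \<omega> * (indicator A \<omega> * W \<omega>))"] that
    by (simp add: sum_negf)
  then have "\<omega> \<notin> A" if "\<omega> \<in> ?I" for \<omega>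
    using qpos[OF that] that by (fastforce simp: A_def)
  then show ?thesis
    unfolding AE_iff_charged_points by (auto simp: A_def W_def charged_points_def not_less)
qed

text \<open>
  Where \<open>V = dP/dQ\<close> is less than \<open>c\<close>, the measure \<open>P\<close> is at most \<open>c\<close> times \<open>Q\<close>. The remaining
  event \<open>V \<ge> c\<close> is the success event of the wealth process \<open>V/c\<close>.
\<close>

lemma numeraire_wealth_test:
  assumes VQ: "numeraire_pair \<gamma> Q" and c: "0 < c"
  shows "\<exists>X\<in>wealth_processes m. (\<forall>\<omega>\<in>space P. X 0 \<omega> = 1 / c) \<and>
    (\<forall>A\<in>sets P. measure P A \<le> c * measure Q A + success_prob m X)"
proof -
  have \<gamma>: "predictable m \<gamma>" and Q: "Q \<in> martingale_measures m"
    and V: "\<And>\<omega>. \<omega> \<in> charged_points P \<Longrightarrow> point_mass P \<omega> = point_mass Q \<omega> * terminal_value \<gamma> \<omega>"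
    using VQ by (auto simp: numeraire_pair_def)
  interpret E: equivalent_finite_prob_spaces P Q by (rule equivalent_if_martingale_measure[OF Q])
  define X where "X t \<omega> = (1 + gains m \<gamma> t \<omega>) / c" for t \<omega>
  have "X \<in> wealth_processes m"
    unfolding wealth_processes_def
  proof (intro CollectI conjI exI allI impI ballI)
    show "predictable m (\<lambda>j i \<omega>. \<gamma> j i \<omega> / c)"
      using \<gamma> unfolding predictable_def
      by (intro ballI borel_measurable_divide borel_measurable_const) blast
    show "X t \<omega> = 1 / c + gains m (\<lambda>j i \<omega>. \<gamma> j i \<omega> / c) t \<omega>" for t \<omega>
      by (simp add: X_def gains_def sum_divide_distrib add_divide_distrib)
    show "AE \<omega> in P. 0 \<le> X t \<omega>" if "t \<le> T" for t
      using numeraire_wealth_nonneg[OF VQ that] c by (simp add: X_def AE_iff_charged_points)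
  qed
  moreover have "X 0 \<omega> = 1 / c" for \<omega>
    by (simp add: X_def gains_def)
  moreover have "measure P A \<le> c * measure Q A + success_prob m X" if A: "A \<in> sets P" for A
  proof -
    let ?B = "{\<omega> \<in> space P. c \<le> terminal_value \<gamma> \<omega>}"
    have B: "?B \<in> sets P" using terminal_value_measurable[OF \<gamma>] by measurable
    have succ: "success_prob m X = measure P ?B"
      using c by (simp add: success_prob_def X_def terminal_value_def le_divide_eq)
    have "measure P A \<le> measure P ((A - ?B) \<union> ?B)"
      by (rule finite_measure_mono) (use A B in auto)
    also have "\<dots> \<le> measure P (A - ?B) + measure P ?B"
      by (rule measure_Un_le) (use A B in auto)
    also have "measure P (A - ?B) \<le> c * measure Q (A - ?B)"
    proof -
      have "point_mass P \<omega> \<le> c * point_mass Q \<omega>" if "\<omega> \<in> A - ?B" for \<omega>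
      proof (cases "\<omega> \<in> charged_points P")
        case True
        then have "terminal_value \<gamma> \<omega> \<le> c" using that by (auto simp: charged_points_def)
        then show ?thesis
          unfolding V[OF True] using E.Q.point_mass_nonneg[of \<omega>]
          by (subst mult.commute[of c]) (rule mult_left_mono)
      next
        case False
        have "\<omega> \<in> space P" using that sets.sets_into_space[OF A] by blast
        with False have "point_mass P \<omega> \<le> 0" by (auto simp: charged_points_def)
        also have "0 \<le> c * point_mass Q \<omega>" using c E.Q.point_mass_nonneg by simp
        finally show ?thesis .
      qed
      then have "(\<Sum>\<omega>\<in>A - ?B. point_mass P \<omega>) \<le> c * (\<Sum>\<omega>\<in>A - ?B. point_mass Q \<omega>)"
        unfolding sum_distrib_left by (intro sum_mono)
      moreover have "A - ?B \<in> sets P" "A - ?B \<in> sets Q" using A B E.sets_eq by auto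
      ultimately show ?thesis
        by (simp only: measure_eq_sum_point_mass E.Q.measure_eq_sum_point_mass)
    qed
    also have "measure Q (A - ?B) \<le> measure Q A"
      by (rule E.Q.finite_measure_mono) (use A E.sets_eq in auto)
    finally show ?thesis using c succ by (simp add: mult_left_mono)
  qed
  ultimately show ?thesis by blast
qed

end

section \<open>Asymptotic arbitrage along a sequence of markets\<close>

text \<open>
  The rate \<open>1 / sqrt a\<close> would do if \<open>a\<close> were positive; a vanishing positive term is added under
  the root.
\<close>

lemma intermediate_divergence_rate:
  fixes a :: "nat \<Rightarrow> real"
  assumes nonneg: "\<And>n. 0 \<le> a n" and lim: "a \<longlonglongrightarrow> 0"
  obtains c :: "nat \<Rightarrow> real" where "\<And>n. 0 < c n" "(\<lambda>n. 1 / c n) \<longlonglongrightarrow> 0" "(\<lambda>n. c n * a n) \<longlonglongrightarrow> 0"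
proof -
  define d where "d n = sqrt (a n + inverse (real (Suc n)))" for n
  have arg_pos: "0 < a n + inverse (real (Suc n))" for n
    using nonneg[of n] by (intro add_nonneg_pos) auto
  have d_pos: "0 < d n" for n unfolding d_def using arg_pos[of n] by (simp only: real_sqrt_gt_0_iff)
  have d_lim: "d \<longlonglongrightarrow> 0"
    unfolding d_def[abs_def]
    using tendsto_real_sqrt[OF tendsto_add[OF lim LIMSEQ_inverse_real_of_nat]] by simp
  have le: "1 / d n * a n \<le> d n" for n
  proof -
    have "a n \<le> d n * d n"
      using arg_pos[of n] unfolding d_def by simp
    then show ?thesis using d_pos[of n] by (simp add: divide_le_eq)
  qed
  have "(\<lambda>n. 1 / d n * a n) \<longlonglongrightarrow> 0"
    by (rule tendsto_sandwich[OF _ _ tendsto_const d_lim])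
       (use d_pos nonneg le in \<open>auto intro!: always_eventually simp: less_imp_le\<close>)
  then show thesis
    using that[of "\<lambda>n. 1 / d n"] d_pos d_lim by simp
qed

locale numeraire_market_sequence =
  fixes m :: "nat \<Rightarrow> 'a market" and \<gamma> :: "nat \<Rightarrow> nat \<Rightarrow> nat \<Rightarrow> 'a \<Rightarrow> real" and Q :: "nat \<Rightarrow> 'a measure"
  assumes model: "\<And>n. 1 \<le> n \<Longrightarrow> market_model (m n)"
    and pair: "\<And>n. 1 \<le> n \<Longrightarrow> market_model.numeraire_pair (m n) (\<gamma> n) (Q n)"
begin

abbreviation "\<P> n \<equiv> prob\<^sub>m (m n)"

abbreviation "success_event X n \<equiv> {\<omega> \<in> space (\<P> n). 1 \<le> X n (horizon\<^sub>m (m n)) \<omega>}"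

lemma success_prob_bounds:
  assumes "1 \<le> n"
  shows "0 \<le> success_prob (m n) X" "success_prob (m n) X \<le> 1"
proof -
  interpret market_model "m n" by (rule model[OF assms])
  show "0 \<le> success_prob (m n) X" "success_prob (m n) X \<le> 1"
    by (simp_all add: success_prob_def)
qed

lemma success_event_vanishes:
  assumes X: "\<And>n. 1 \<le> n \<Longrightarrow> X n \<in> wealth_processes (m n)" and X0: "vanishing_initial m X"
  shows "\<And>n. 1 \<le> n \<Longrightarrow> success_event X n \<in> sets (\<P> n)"
    and "(\<lambda>n. measure (Q n) (success_event X n)) \<longlonglongrightarrow> 0"
proof -
  obtain x where x: "\<And>n \<omega>. 1 \<le> n \<Longrightarrow> \<omega> \<in> space (\<P> n) \<Longrightarrow> X n 0 \<omega> = x n" and lim: "x \<longlonglongrightarrow> 0"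
    using X0 by (auto simp: vanishing_initial_def)
  have bound: "success_event X n \<in> sets (\<P> n)" "measure (Q n) (success_event X n) \<le> x n"
    if n: "1 \<le> n" for n
  proof -
    interpret market_model "m n" by (rule model[OF n])
    have "Q n \<in> martingale_measures (m n)"
      using pair[OF n] by (simp add: numeraire_pair_def)
    note martingale_measure_wealth_bound[OF this X[OF n] x[OF n]]
    then show "success_event X n \<in> sets (\<P> n)" "measure (Q n) (success_event X n) \<le> x n"
      by blast+
  qed
  show "success_event X n \<in> sets (\<P> n)" if "1 \<le> n" for n
    by (rule bound(1)[OF that])
  show "(\<lambda>n. measure (Q n) (success_event X n)) \<longlonglongrightarrow> 0"
  proof (rule tendsto_sandwich[OF _ _ tendsto_const lim])
    show "\<forall>\<^sub>F n in sequentially. measure (Q n) (success_event X n) \<le> x n"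
      using bound(2) by (intro eventually_sequentiallyI[of 1])
  qed simp
qed

text \<open>
  If events have \<open>Q\<close>-probability at most \<open>a n\<close>, where \<open>a\<close> tends to 0, then a single sequence of
  wealth processes with vanishing initial capital succeeds, up to a vanishing error, at least as
  often as these events occur. It is \<open>V/c\<close> with \<open>c\<close> from \<open>intermediate_divergence_rate\<close>.
\<close>

lemma test_wealth_sequence:
  assumes a: "\<And>n. 0 \<le> a n" "a \<longlonglongrightarrow> 0"
  obtains X e where "\<And>n. 1 \<le> n \<Longrightarrow> X n \<in> wealth_processes (m n)" "vanishing_initial m X" "e \<longlonglongrightarrow> 0"
    "\<And>n A. 1 \<le> n \<Longrightarrow> A \<in> sets (\<P> n) \<Longrightarrow> measure (Q n) A \<le> a n \<Longrightarrow>
      measure (\<P> n) A \<le> e n + success_prob (m n) (X n)"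
proof -
  obtain c :: "nat \<Rightarrow> real" where c: "\<And>n. 0 < c n" "(\<lambda>n. 1 / c n) \<longlonglongrightarrow> 0" "(\<lambda>n. c n * a n) \<longlonglongrightarrow> 0"
    using intermediate_divergence_rate[OF a] by blast
  have "\<exists>X. 1 \<le> n \<longrightarrow> X \<in> wealth_processes (m n) \<and> (\<forall>\<omega>\<in>space (\<P> n). X 0 \<omega> = 1 / c n) \<and>
      (\<forall>A\<in>sets (\<P> n). measure (\<P> n) A \<le> c n * measure (Q n) A + success_prob (m n) X)" for n
  proof (cases "1 \<le> n")
    case True
    interpret market_model "m n" by (rule model[OF True])
    show ?thesis using numeraire_wealth_test[OF pair[OF True] c(1)[of n]] by blast
  qed simp
  then obtain X where X: "\<And>n. 1 \<le> n \<Longrightarrow> X n \<in> wealth_processes (m n) \<and>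
      (\<forall>\<omega>\<in>space (\<P> n). X n 0 \<omega> = 1 / c n) \<and>
      (\<forall>A\<in>sets (\<P> n). measure (\<P> n) A \<le> c n * measure (Q n) A + success_prob (m n) (X n))"
    by metis
  show thesis
  proof (rule that[of X "\<lambda>n. c n * a n"])
    show "X n \<in> wealth_processes (m n)" if "1 \<le> n" for n
      using X[OF that] by blast
    show "vanishing_initial m X"
      unfolding vanishing_initial_def using X c(2) by (intro exI[of _ "\<lambda>n. 1 / c n"]) simp
    show "measure (\<P> n) A \<le> c n * a n + success_prob (m n) (X n)"
      if "1 \<le> n" "A \<in> sets (\<P> n)" "measure (Q n) A \<le> a n" for n A
    proof -
      have "measure (\<P> n) A \<le> c n * measure (Q n) A + success_prob (m n) (X n)"
        using X[OF that(1)] that(2) by blast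
      also have "c n * measure (Q n) A \<le> c n * a n"
        using that(3) c(1)[of n] by simp
      finally show ?thesis by simp
    qed
  qed (rule c(3))
qed

lemma NAA_iff_contiguous: "NAA m \<longleftrightarrow> contiguous \<P> Q"
proof
  assume NAA: "NAA m"
  show "contiguous \<P> Q"
    unfolding contiguous_def
  proof (intro allI impI)
    fix A assume A: "\<forall>n\<ge>1. A n \<in> sets (\<P> n)" and QA: "(\<lambda>n. measure (Q n) (A n)) \<longlonglongrightarrow> 0"
    obtain X e where X: "\<And>n. 1 \<le> n \<Longrightarrow> X n \<in> wealth_processes (m n)" "vanishing_initial m X"
      and e: "e \<longlonglongrightarrow> 0"
      and test: "\<And>n B. 1 \<le> n \<Longrightarrow> B \<in> sets (\<P> n) \<Longrightarrow> measure (Q n) B \<le> measure (Q n) (A n) \<Longrightarrow>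
        measure (\<P> n) B \<le> e n + success_prob (m n) (X n)"
      by (rule test_wealth_sequence[OF measure_nonneg QA]) blast
    have "limsup (\<lambda>n. ereal (success_prob (m n) (X n))) = 0"
      using NAA X unfolding NAA_def by blast
    moreover have "0 \<le> liminf (\<lambda>n. ereal (success_prob (m n) (X n)))"
      by (rule Liminf_bounded, rule eventually_sequentiallyI[of 1]) (simp add: success_prob_bounds)
    moreover have "liminf (\<lambda>n. ereal (success_prob (m n) (X n)))
        \<le> limsup (\<lambda>n. ereal (success_prob (m n) (X n)))"
      by (simp add: Liminf_le_Limsup)
    ultimately have "(\<lambda>n. success_prob (m n) (X n)) \<longlonglongrightarrow> 0"
      by (intro limsup_le_liminf_real) (simp_all add: zero_ereal_def)
    from tendsto_add[OF e this] have lim: "(\<lambda>n. e n + success_prob (m n) (X n)) \<longlonglongrightarrow> 0" by simp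
    show "(\<lambda>n. measure (\<P> n) (A n)) \<longlonglongrightarrow> 0"
    proof (rule tendsto_sandwich[OF _ _ tendsto_const lim])
      show "\<forall>\<^sub>F n in sequentially. measure (\<P> n) (A n) \<le> e n + success_prob (m n) (X n)"
        by (rule eventually_sequentiallyI[of 1]) (use test A in blast)
    qed simp
  qed
next
  assume cont: "contiguous \<P> Q"
  show "NAA m"
    unfolding NAA_def
  proof (intro allI impI)
    fix X assume X: "\<forall>n\<ge>1. X n \<in> wealth_processes (m n)" and X0: "vanishing_initial m X"
    have "(\<lambda>n. measure (\<P> n) (success_event X n)) \<longlonglongrightarrow> 0"
    proof -
      have "\<forall>n\<ge>1. success_event X n \<in> sets (\<P> n)"
        "(\<lambda>n. measure (Q n) (success_event X n)) \<longlonglongrightarrow> 0"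
        using success_event_vanishes[of X] X X0 by auto
      with cont show ?thesis
        unfolding contiguous_def by (elim allE[of _ "success_event X"]) simp
    qed
    then have "(\<lambda>n. ereal (success_prob (m n) (X n))) \<longlonglongrightarrow> ereal 0"
      by (simp add: success_prob_def)
    from lim_imp_Limsup[OF _ this] show "limsup (\<lambda>n. ereal (success_prob (m n) (X n))) = 0"
      by (simp add: zero_ereal_def)
  qed
qed

lemma SAA_iff_entirely_separated: "SAA m \<longleftrightarrow> entirely_separated \<P> Q"
proof
  assume "SAA m"
  then obtain X where X: "\<And>n. 1 \<le> n \<Longrightarrow> X n \<in> wealth_processes (m n)" and X0: "vanishing_initial m X"
    and one: "limsup (\<lambda>n. ereal (success_prob (m n) (X n))) = 1"
    unfolding SAA_def by blast
  obtain r where r: "strict_mono r"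
    and lim: "((\<lambda>n. ereal (success_prob (m n) (X n))) \<circ> r) \<longlonglongrightarrow> 1"
    using limsup_subseq_lim[of "\<lambda>n. ereal (success_prob (m n) (X n))"] one by auto
  \<comment> \<open>Dropping the first term ensures that all indices are positive.\<close>
  define r' where "r' k = r (Suc k)" for k
  have r': "strict_mono r'"
    using r by (auto simp: strict_mono_def r'_def)
  have pos: "1 \<le> r' k" for k
    using strict_mono_imp_increasing[OF r, of "Suc k"] by (simp add: r'_def)
  have "(\<lambda>k. measure (\<P> (r' k)) (success_event X (r' k))) \<longlonglongrightarrow> 1"
    using LIMSEQ_Suc[OF lim] by (simp add: r'_def success_prob_def one_ereal_def)
  moreover have "(\<lambda>k. measure (Q (r' k)) (success_event X (r' k))) \<longlonglongrightarrow> 0"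
    using LIMSEQ_subseq_LIMSEQ[OF success_event_vanishes(2)[OF X X0] r'] by (simp add: o_def)
  ultimately show "entirely_separated \<P> Q"
    unfolding entirely_separated_def using r' pos success_event_vanishes(1)[OF X X0]
    by (intro exI[of _ r'] exI[of _ "success_event X"] conjI allI) auto
next
  assume "entirely_separated \<P> Q"
  then obtain r A where r: "strict_mono r" and pos: "\<And>k. 1 \<le> r k"
    and A: "\<And>k. A (r k) \<in> sets (\<P> (r k))"
    and PA: "(\<lambda>k. measure (\<P> (r k)) (A (r k))) \<longlonglongrightarrow> 1"
    and QA: "(\<lambda>k. measure (Q (r k)) (A (r k))) \<longlonglongrightarrow> 0"
    unfolding entirely_separated_def by blast
  \<comment> \<open>Indices outside the subsequence impose no constraint on the events, so \<open>a\<close> may vanish there.\<close>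
  define a where "a n = (if n \<in> range r then measure (Q n) (A n) else 0)" for n
  have a_nonneg: "0 \<le> a n" for n by (simp add: a_def)
  have "a \<longlonglongrightarrow> 0"
  proof (rule LIMSEQ_I)
    fix \<epsilon> :: real assume "0 < \<epsilon>"
    then obtain N where N: "\<And>k. N \<le> k \<Longrightarrow> measure (Q (r k)) (A (r k)) < \<epsilon>"
      using LIMSEQ_D[OF QA] by fastforce
    have "norm (a n - 0) < \<epsilon>" if "r N \<le> n" for n
      using that N \<open>0 < \<epsilon>\<close> strict_mono_less_eq[OF r] by (auto simp: a_def)
    then show "\<exists>no. \<forall>n\<ge>no. norm (a n - 0) < \<epsilon>" by blast
  qed
  then obtain X e where X: "\<And>n. 1 \<le> n \<Longrightarrow> X n \<in> wealth_processes (m n)" "vanishing_initial m X"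
    and e: "e \<longlonglongrightarrow> 0"
    and test: "\<And>n B. 1 \<le> n \<Longrightarrow> B \<in> sets (\<P> n) \<Longrightarrow> measure (Q n) B \<le> a n \<Longrightarrow>
      measure (\<P> n) B \<le> e n + success_prob (m n) (X n)"
    by (rule test_wealth_sequence[OF a_nonneg]) blast
  let ?s = "\<lambda>n. success_prob (m n) (X n)"
  have lower: "measure (\<P> (r k)) (A (r k)) - e (r k) \<le> ?s (r k)" for k
    using test[OF pos A, of k] by (simp add: a_def)
  have "(\<lambda>k. e (r k)) \<longlonglongrightarrow> 0"
    using LIMSEQ_subseq_LIMSEQ[OF e r] by (simp add: o_def)
  from tendsto_diff[OF PA this] have low: "(\<lambda>k. measure (\<P> (r k)) (A (r k)) - e (r k)) \<longlonglongrightarrow> 1"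
    by simp
  have "(\<lambda>k. ?s (r k)) \<longlonglongrightarrow> 1"
    by (rule tendsto_sandwich[OF _ _ low tendsto_const])
       (use lower success_prob_bounds(2)[OF pos] in auto)
  then have "((\<lambda>n. ereal (?s n)) \<circ> r) \<longlonglongrightarrow> 1"
    by (simp add: o_def one_ereal_def)
  then have "limsup ((\<lambda>n. ereal (?s n)) \<circ> r) = 1"
    by (rule lim_imp_Limsup[rotated]) simp
  then have "1 \<le> limsup (\<lambda>n. ereal (?s n))"
    using limsup_subseq_mono[OF r, of "\<lambda>n. ereal (?s n)"] by simp
  moreover have "limsup (\<lambda>n. ereal (?s n)) \<le> 1"
    by (rule Limsup_bounded, rule eventually_sequentiallyI[of 1])
       (simp add: success_prob_bounds)
  ultimately show "SAA m"
    unfolding SAA_def using X by (intro exI[of _ X]) auto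
qed

end

theorem theorem3p1:
  fixes m :: "nat \<Rightarrow> 'a market"
  assumes "\<And>n. n \<ge> 1 \<Longrightarrow> finite_market (m n)"
    and "\<And>n. n \<ge> 1 \<Longrightarrow> martingale_measures (m n) \<noteq> {}"
  shows "(\<forall>n\<ge>1. \<exists>!Q. min_reverse_entropy_mm (m n) Q) \<and>
    (\<forall>Q. (\<forall>n\<ge>1. min_reverse_entropy_mm (m n) (Q n)) \<longrightarrow>
      (NAA m \<longleftrightarrow> contiguous (\<lambda>n. prob\<^sub>m (m n)) Q) \<and>
      (SAA m \<longleftrightarrow> entirely_separated (\<lambda>n. prob\<^sub>m (m n)) Q))"
proof -
  have model: "market_model (m n)" if "1 \<le> n" for n
    using assms(1)[OF that] by unfold_locales
  have "\<exists>\<gamma> Q. 1 \<le> n \<longrightarrow> market_model.numeraire_pair (m n) \<gamma> Q" for n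
    using market_model.numeraire_pair_exists[OF model assms(2)] by blast
  then obtain \<gamma> Q0 where pair: "\<And>n. 1 \<le> n \<Longrightarrow> market_model.numeraire_pair (m n) (\<gamma> n) (Q0 n)"
    by metis
  have min_iff: "min_reverse_entropy_mm (m n) Q \<longleftrightarrow> Q = Q0 n" if "1 \<le> n" for n Q
    using market_model.numeraire_pair_min_reverse_entropy[OF model[OF that] pair[OF that]] .
  have "(NAA m \<longleftrightarrow> contiguous (\<lambda>n. prob\<^sub>m (m n)) Q) \<and>
      (SAA m \<longleftrightarrow> entirely_separated (\<lambda>n. prob\<^sub>m (m n)) Q)"
    if "\<forall>n\<ge>1. min_reverse_entropy_mm (m n) (Q n)" for Q
  proof -
    interpret numeraire_market_sequence m \<gamma> Q
      by unfold_locales (use assms(1) pair min_iff that in auto)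
    show ?thesis
      using NAA_iff_contiguous SAA_iff_entirely_separated by simp
  qed
  then show ?thesis using min_iff by auto
qed

end
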